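(* Let $\xi,\eta\in E_2$, where $E_2\subset\{0,1\}^\omega$ is the set of infinite binary words whose Schreier graph for the Basilica group has two ends. Then $\Gamma_\xi$ and $\Gamma_\eta$ are isomorphic as unrooted graphs if and only if either $\xi\sim\eta$ or $\overline{\xi}\sim\eta$. In particular, each isomorphism class of 2-ended graphs $\Gamma_\xi$ consists of exactly two orbits of the action of the Basilica group on $\{0,1\}^\omega$.
   Context: The Basilica group $B=\langle a,b\rangle$ acts on finite and infinite binary words by $a(0w)=0\,b(w)$, $a(1w)=1w$, $b(0w)=1\,a(w)$, $b(1w)=0w$. For $\xi\in\{0,1\}^\omega$, the Schreier graph $\Gamma_\xi$ is the undirected (unlabeled) multigraph with vertex set $B\cdot\xi$ and, for every vertex $x$ and $s\in\{a,b\}$, one edge joining $x$ and $s(x)$ (a loop if $s(x)=x$; parallel edges allowed). $\xi\sim\eta$ means that $\xi,\eta$ are cofinal, i.e. differ in only finitely many letters. Explicitly, $E_2$ is the set of $\xi=\alpha_1\beta_1\alpha_2\beta_2\ldots$ ($\alpha_i,\beta_i\in\{0,1\}$) such that at least one of the sequences $\{\alpha_i\},\{\beta_i\}$ contains only finitely many $1$'s and $\xi$ is not of the form $w0^\omega$ or $w(01)^\omega$ with $w$ a finite word. Definition of $\overline\xi$ for $\xi=\alpha_1\beta_1\alpha_2\beta_2\ldots\in E_2$: let $w$ be the longest prefix of $\xi$ ending by a subword of the form $10^k1$ with $k\ge 0$ even; if $\alpha_i=0$ for all $i$, let $w$ be the empty word; if $\beta_i=0$ for all $i$, let $w$ be the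 prefix of $\xi$ of length 1. Then $\xi=w0x_10x_2\ldots$ with $x_i\in\{0,1\}$, and $\overline\xi:=w0\overline{x}_10\overline{x}_2\ldots$ with $\overline{x}_i=1-x_i$. *)

theory Defs
  imports "HOL-Library.Stream" "HOL-Library.Uprod" "HOL-Algebra.Group_Action"
    "HOL-Algebra.Generated_Groups"
begin

text \<open>Infinite binary words are streams of truth values, with \<^term>\<open>False\<close> for the letter 0 and
  \<^term>\<open>True\<close> for the letter 1.\<close>

type_synonym word = "bool stream"

datatype generator = Gen_a | Gen_b

fun swap_gen :: "generator \<Rightarrow> generator" where
  "swap_gen Gen_a = Gen_b"
| "swap_gen Gen_b = Gen_a"

text \<open>The mutual recursion of the two generators, as one corecursive function; lemma \<open>act_rec\<close>
  below gives the four defining equations.\<close>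

primcorec act :: "generator \<Rightarrow> word \<Rightarrow> word" where
  "act s \<xi> = (if s = Gen_a then shd \<xi> else \<not> shd \<xi>) ##
     (if shd \<xi> then stl \<xi> else act (swap_gen s) (stl \<xi>))"

lemma act_rec:
  "act Gen_a (False ## w) = False ## act Gen_b w"
  "act Gen_a (True ## w) = True ## w"
  "act Gen_b (False ## w) = True ## act Gen_a w"
  "act Gen_b (True ## w) = False ## w"
  by (subst act.code, simp)+

primcorec act_inv :: "generator \<Rightarrow> word \<Rightarrow> word" where
  "act_inv s \<xi> = (if s = Gen_a then shd \<xi> else \<not> shd \<xi>) ##
     (if shd \<xi> = (s = Gen_a) then stl \<xi> else act_inv (swap_gen s) (stl \<xi>))"

lemma act_inv_left: "act_inv s (act s \<xi>) = \<xi>"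
proof -
  have "act_inv s (act s \<xi>) !! n = \<xi> !! n" for n
    by (induction n arbitrary: s \<xi>) auto
  then show ?thesis
    using smap_alt[of id "act_inv s (act s \<xi>)" \<xi>] by (simp add: stream.map_id)
qed

lemma act_inv_right: "act s (act_inv s \<xi>) = \<xi>"
proof -
  have "act s (act_inv s \<xi>) !! n = \<xi> !! n" for n
    by (induction n arbitrary: s \<xi>) auto
  then show ?thesis
    using smap_alt[of id "act s (act_inv s \<xi>)" \<xi>] by (simp add: stream.map_id)
qed

lemma act_in_carrier: "range act \<subseteq> carrier (BijGroup UNIV)"
proof -
  have "bij (act s)" for s
    by (rule o_bij[of "act_inv s"]) (simp_all add: fun_eq_iff act_inv_left act_inv_right)
  then show ?thesis
    by (auto simp: BijGroup_def Bij_def)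
qed

definition basilica :: "(word \<Rightarrow> word) monoid" where
  "basilica = (BijGroup UNIV)\<lparr>carrier := generate (BijGroup UNIV) (range act)\<rparr>"

definition basilica_orbit :: "word \<Rightarrow> word set" where
  "basilica_orbit \<xi> = orbit basilica (\<lambda>g. g) \<xi>"

text \<open>Undirected multigraphs: an edge has an unordered pair of endpoints, which is
  \<^term>\<open>Upair x x\<close> for a loop.\<close>

record ('v, 'e) multigraph =
  verts :: "'v set"
  edges :: "'e set"
  endpoints :: "'e \<Rightarrow> 'v uprod"

definition multigraph_iso ::
    "('v, 'e) multigraph \<Rightarrow> ('w, 'f) multigraph \<Rightarrow> bool" where
  "multigraph_iso G H \<longleftrightarrow>
     (\<exists>f g. bij_betw f (verts G) (verts H) \<and> bij_betw g (edges G) (edges H) \<and>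
        (\<forall>e\<in>edges G. endpoints H (g e) = map_uprod f (endpoints G e)))"

definition adjacent_off :: "('v, 'e) multigraph \<Rightarrow> 'v set \<Rightarrow> 'v \<Rightarrow> 'v \<Rightarrow> bool" where
  "adjacent_off G K x y \<longleftrightarrow>
     x \<in> verts G - K \<and> y \<in> verts G - K \<and> (\<exists>e\<in>edges G. endpoints G e = Upair x y)"

definition rays :: "('v, 'e) multigraph \<Rightarrow> (nat \<Rightarrow> 'v) set" where
  "rays G = {r. inj r \<and> (\<forall>i. adjacent_off G {} (r i) (r (Suc i)))}"

text \<open>Two rays are equivalent if no finite vertex set separates them: for every finite \<open>K\<close> they
  have tails in the same connected component of the graph with \<open>K\<close> deleted.\<close>

definition ray_equiv :: "('v, 'e) multigraph \<Rightarrow> ((nat \<Rightarrow> 'v) \<times> (nat \<Rightarrow> 'v)) set" where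
  "ray_equiv G = {(r, r'). r \<in> rays G \<and> r' \<in> rays G \<and>
     (\<forall>K. finite K \<longrightarrow>
        (\<exists>N. \<forall>m\<ge>N. \<forall>n\<ge>N. r m \<notin> K \<and> r' n \<notin> K \<and> (adjacent_off G K)\<^sup>*\<^sup>* (r m) (r' n)))}"

definition graph_ends :: "('v, 'e) multigraph \<Rightarrow> (nat \<Rightarrow> 'v) set set" where
  "graph_ends G = rays G // ray_equiv G"

text \<open>The edge \<open>(x, s)\<close> is the one contributed by the vertex \<open>x\<close> and the generator \<open>s\<close>; distinct
  edges may be parallel.\<close>

definition schreier_graph :: "word \<Rightarrow> (word, word \<times> generator) multigraph" where
  "schreier_graph \<xi> =
     \<lparr>verts = basilica_orbit \<xi>,
      edges = basilica_orbit \<xi> \<times> UNIV,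
      endpoints = (\<lambda>(x, s). Upair x (act s x))\<rparr>"

definition E2 :: "word set" where
  "E2 = {\<xi>. card (graph_ends (schreier_graph \<xi>)) = 2}"

definition cofinal_words :: "word \<Rightarrow> word \<Rightarrow> bool" where
  "cofinal_words \<xi> \<eta> \<longleftrightarrow> finite {n. \<xi> !! n \<noteq> \<eta> !! n}"

text \<open>The length of the prefix \<open>w\<close> of \<open>\<xi> = \<alpha>\<^sub>1\<beta>\<^sub>1\<alpha>\<^sub>2\<beta>\<^sub>2\<dots>\<close> after which the letters \<open>0\<close>
  and \<open>x\<^sub>i\<close> alternate. As streams are indexed from 0, the even positions carry the \<open>\<alpha>\<^sub>i\<close> and the
  odd ones the \<open>\<beta>\<^sub>i\<close>. The value is meaningful for \<open>\<xi>\<close> in \<^term>\<open>E2\<close> only; elsewhere there need not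
  be a longest prefix as in the last case.\<close>

definition bar_prefix_length :: "word \<Rightarrow> nat" where
  "bar_prefix_length \<xi> =
     (if \<forall>i. \<not> \<xi> !! (2 * i) then 0
      else if \<forall>i. \<not> \<xi> !! (2 * i + 1) then 1
      else (GREATEST n. \<exists>u k. even k \<and>
              stake n \<xi> = u @ [True] @ replicate k False @ [True]))"

definition bar :: "word \<Rightarrow> word" where
  "bar \<xi> = (let n = bar_prefix_length \<xi> in
     stake n \<xi> @- smap (\<lambda>j. if even j then False else \<not> sdrop n \<xi> !! j) nats)"

end

theory Submission
  imports Defs "HOL-Library.Infinite_Set"
begin

text \<open>The generator \<open>s\<close> changes the letter at position \<open>i\<close> of \<open>x\<close> exactly if all earlier letters are 0 and
\<open>i\<close> has the parity of \<open>s\<close> (even for \<open>b\<close>, odd for \<open>a\<close>, counted from 0;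
lemma \<open>act_snth\<close>). The edges and the orbits of the Schreier graphs can be read off from this rule, letter by letter.

Call the positions of the parity of \<open>s\<close> the digits of \<open>s\<close>, and let the axis of \<open>s\<close> be the set of
words whose 1s all are digits of \<open>s\<close>. If the digits are read as a 2-adic integer, then \<open>s\<close> acts on
its axis as \<open>x \<mapsto> x - 1\<close>. A word with a 2-ended graph is cofinal with a word on the axis of one of
the generators \<open>s\<close>, and this 2-adic integer is not in \<open>\<int>\<close> (lemma \<open>E2_two_ended_word\<close>). Otherwise
the orbit contains \<open>0\<^sup>\<omega>\<close>, where at least three ends meet, or both parities carry infinitely many
1s, and then the complements of arbitrarily large finite pieces are connected.

For such a word the axis is a bi-infinite path in the graph, and the rest of the graph consists of
finite pieces, each of which hangs at one vertex of the axis; the map \<open>retract s\<close> sends every vertex to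
that place. The size of the piece at \<open>x\<close> is a strictly monotone function of the position of the first
1 of \<open>x\<close>, that is, of the 2-adic valuation of \<open>x\<close> (lemma \<open>card_fibre_less\<close>). The negation
\<open>x \<mapsto> -x\<close> on the axis keeps valuations and reverses the path, and it extends to the whole graph, with
every piece carried over unchanged. This is the map \<open>mirror s\<close>, an isomorphism from the graph of \<open>\<xi>\<close>
to the graph of \<open>mirror s \<xi>\<close>. As \<open>-x\<close> arises from \<open>x\<close> by complementing the digits above the lowest
1, \<open>mirror s \<xi>\<close> is cofinal with \<open>bar \<xi>\<close>.

Conversely, an isomorphism between two such graphs maps axis to axis, because the vertices of the axis
are those whose removal leaves two infinite components. The axes belong to the same generator, because
the axis of \<open>b\<close> has loops and that of \<open>a\<close> has none. Both axes are paths, so the isomorphism sends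
\<open>s\<^sup>n x\<close> to \<open>s\<^sup>n y\<close> for all \<open>n\<close> or to \<open>s\<^bsup>-n\<^esup> y\<close> for all \<open>n\<close>, and it preserves the sizes of the pieces.
Hence \<open>x - n\<close> has the same valuation as \<open>y - n\<close>, or as \<open>-y - n\<close>, for all \<open>n \<in> \<nat>\<close>. The valuations of
\<open>x - n\<close> determine the 2-adic integer \<open>x\<close> (lemma \<open>axis_eq_from_first_ones\<close>), so \<open>x = y\<close> or \<open>x = -y\<close>.\<close>

section \<open>Letters of words and the action\<close>

lemma word_eqI:
  fixes x y :: word
  assumes "\<And>i. x !! i = y !! i"
  shows "x = y"
  using smap_alt[of id x y] assms by (simp add: stream.map_id)

text \<open>The positions at which \<open>s\<close> can change a letter: odd for \<open>a\<close>, even for \<open>b\<close>, with positions counted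
  from 0. They are the digits of \<open>s\<close> in the 2-adic reading.\<close>

definition flips :: "generator \<Rightarrow> nat \<Rightarrow> bool" where
  "flips s i \<longleftrightarrow> (even i \<longleftrightarrow> s = Gen_b)"

definition zero_below :: "nat \<Rightarrow> word \<Rightarrow> bool" where
  "zero_below i x \<longleftrightarrow> (\<forall>j<i. \<not> x !! j)"

lemma flips_Suc: "flips s (Suc i) \<longleftrightarrow> \<not> flips s i"
  by (auto simp: flips_def)

lemma flips_swap_gen: "flips (swap_gen s) i \<longleftrightarrow> \<not> flips s i"
  by (cases s) (auto simp: flips_def)

lemma flips_other: "s \<noteq> t \<Longrightarrow> flips t i \<longleftrightarrow> \<not> flips s i"
  by (cases s; cases t) (auto simp: flips_def)

lemma ex_flips: "\<exists>s. flips s i"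
  using flips_swap_gen by blast

lemma zero_below_0 [simp]: "zero_below 0 x"
  by (simp add: zero_below_def)

lemma zero_below_Suc: "zero_below (Suc i) x \<longleftrightarrow> zero_below i x \<and> \<not> x !! i"
  by (auto simp: zero_below_def less_Suc_eq)

lemma zero_below_shift: "zero_below (Suc i) x \<longleftrightarrow> \<not> shd x \<and> zero_below i (stl x)"
  unfolding zero_below_def
  by (metis Suc_mono less_Suc_eq_0_disj snth.simps)

lemma zero_below_snthD: "zero_below i x \<Longrightarrow> x !! j \<Longrightarrow> i \<le> j"
  by (meson leI zero_below_def)

text \<open>Unfolding the mutual recursion: it descends through a prefix of 0s, and each step exchanges the roles
  of \<open>a\<close> and \<open>b\<close>; behind the first 1 nothing changes.\<close>

lemma act_snth: "act s x !! i \<longleftrightarrow> x !! i \<noteq> (flips s i \<and> zero_below i x)"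
proof (induction i arbitrary: s x)
  case 0
  show ?case by (cases s) (auto simp: flips_def)
next
  case (Suc i)
  show ?case
    using Suc[of "swap_gen s" "stl x"]
    by (auto simp: zero_below_shift flips_swap_gen flips_Suc)
qed

lemma act_snth_after_one: "x !! j \<Longrightarrow> j < i \<Longrightarrow> act s x !! i = x !! i"
  by (auto simp: act_snth zero_below_def)

lemma act_snth_fixed: "\<not> flips s i \<Longrightarrow> act s x !! i = x !! i"
  by (simp add: act_snth)

lemma act_eq_iff: "act s x = act s y \<longleftrightarrow> x = y"
  by (metis act_inv_left)

lemma act_pow_inject: "(act s ^^ n) x = (act s ^^ n) y \<longleftrightarrow> x = y"
  by (induction n) (auto simp: act_eq_iff)

section \<open>Connectedness and orbits\<close>

text \<open>Adjacency in any of the Schreier graphs; the multiplicities of edges are forgotten.\<close>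

definition step :: "word \<Rightarrow> word \<Rightarrow> bool" where
  "step x y \<longleftrightarrow> (\<exists>s. y = act s x \<or> x = act s y)"

definition adj :: "word set \<Rightarrow> word \<Rightarrow> word \<Rightarrow> bool" where
  "adj S x y \<longleftrightarrow> x \<in> S \<and> y \<in> S \<and> step x y"

definition tail_class :: "nat \<Rightarrow> word \<Rightarrow> word set" where
  "tail_class n x = {y. \<forall>i\<ge>n. y !! i = x !! i}"

lemma step_act [simp]: "step x (act s x)" "step (act s x) x"
  by (auto simp: step_def)

lemma step_act_inv [simp]: "step x (act_inv s x)" "step (act_inv s x) x"
  by (metis act_inv_right step_act)+

lemma step_sym: "step x y \<Longrightarrow> step y x"
  by (auto simp: step_def)

lemma adj_sym: "adj S x y \<Longrightarrow> adj S y x"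
  by (auto simp: adj_def step_sym)

lemma adj_rtranclp_sym: "(adj S)\<^sup>*\<^sup>* x y \<Longrightarrow> (adj S)\<^sup>*\<^sup>* y x"
  by (induction rule: rtranclp_induct) (auto dest: adj_sym intro: converse_rtranclp_into_rtranclp)

lemma adj_rtranclp_mono: "S \<subseteq> T \<Longrightarrow> (adj S)\<^sup>*\<^sup>* x y \<Longrightarrow> (adj T)\<^sup>*\<^sup>* x y"
  by (erule rtranclp_mono[THEN predicate2D, rotated]) (auto simp: adj_def)

lemma adj_rtranclp_in: "(adj S)\<^sup>*\<^sup>* x y \<Longrightarrow> x \<in> S \<Longrightarrow> y \<in> S"
  by (induction rule: rtranclp_induct) (auto simp: adj_def)

lemma adj_rtranclp_step: "(adj S)\<^sup>*\<^sup>* x y \<Longrightarrow> step\<^sup>*\<^sup>* x y"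
  by (erule rtranclp_mono[THEN predicate2D, rotated]) (auto simp: adj_def)

lemma tail_class_self [simp]: "x \<in> tail_class n x"
  by (simp add: tail_class_def)

lemma tail_class_mono: "n \<le> m \<Longrightarrow> tail_class n x \<subseteq> tail_class m x"
  by (auto simp: tail_class_def)

lemma tail_class_SCons: "c ## y \<in> tail_class (Suc n) (d ## x) \<longleftrightarrow> y \<in> tail_class n x"
proof -
  have "(\<forall>i\<ge>Suc n. P i) \<longleftrightarrow> (\<forall>i\<ge>n. P (Suc i))" for P
    by (metis Suc_le_D Suc_le_mono)
  then show ?thesis
    by (simp add: tail_class_def)
qed

lemma finite_tail_class: "finite (tail_class n x)"
proof (rule inj_on_finite[of "\<lambda>y. {i. i < n \<and> y !! i}" _ "Pow {..<n}"])
  show "inj_on (\<lambda>y. {i. i < n \<and> y !! i}) (tail_class n x)"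
  proof (rule inj_onI)
    fix y z
    assume "y \<in> tail_class n x" "z \<in> tail_class n x"
      and eq: "{i. i < n \<and> y !! i} = {i. i < n \<and> z !! i}"
    then have "y !! i = z !! i" for i
      by (cases "i < n") (auto simp: tail_class_def set_eq_iff)
    then show "y = z" by (rule word_eqI)
  qed
qed auto

text \<open>Words with a common tail are joined by a path along which this tail is constant. One letter more can
  be prefixed because the \<open>b\<close>-edge \<open>1z \<mapsto> 0z\<close> adjusts that letter, and because every edge of the shorter
  words lifts to a path.\<close>

lemma tail_class_connected:
  assumes "y \<in> tail_class n x"
  shows "(adj (tail_class n x))\<^sup>*\<^sup>* x y"
  using assms
proof (induction n arbitrary: x y)
  case 0
  then have "y = x" by (intro word_eqI) (simp add: tail_class_def)
  then show ?case by simp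
next
  case (Suc n)
  let ?T = "tail_class (Suc n) x"
  obtain c x' d y' where xy: "x = c ## x'" "y = d ## y'"
    by (metis stream.exhaust)
  have y': "y' \<in> tail_class n x'"
    using Suc.prems by (simp add: xy tail_class_SCons)
  have in_T: "e ## z \<in> ?T" if "z \<in> tail_class n x'" for e z
    using that by (simp add: xy tail_class_SCons)
  have head: "(adj ?T)\<^sup>*\<^sup>* (e ## z) (False ## z)" if "z \<in> tail_class n x'" for e z
  proof (cases e)
    case True
    then have "adj ?T (e ## z) (False ## z)"
      using in_T[OF that] step_act(1)[of "True ## z" Gen_b] by (auto simp: adj_def act_rec)
    then show ?thesis by blast
  qed simp
  \<comment> \<open>The edge \<open>0z \<mapsto> 0b(z)\<close> is an \<open>a\<close>-edge; \<open>0a(z)\<close> is reached from \<open>0z\<close> by applying \<open>b\<close> twice.\<close>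
  have lift: "(adj ?T)\<^sup>*\<^sup>* (False ## p) (False ## act s p)"
    if p: "p \<in> tail_class n x'" and q: "act s p \<in> tail_class n x'" for p s
  proof (cases s)
    case Gen_a
    have "adj ?T (False ## p) (True ## act s p)"
      using in_T p q step_act(1)[of "False ## p" Gen_b] by (auto simp: adj_def act_rec Gen_a)
    then show ?thesis
      using head[OF q] by (meson converse_rtranclp_into_rtranclp)
  next
    case Gen_b
    have "adj ?T (False ## p) (False ## act s p)"
      using in_T p q step_act(1)[of "False ## p" Gen_a] by (auto simp: adj_def act_rec Gen_b)
    then show ?thesis by blast
  qed
  have "(adj (tail_class n x'))\<^sup>*\<^sup>* x' y'"
    by (rule Suc.IH[OF y'])
  then have "(adj ?T)\<^sup>*\<^sup>* (False ## x') (False ## y')"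
  proof (induction rule: rtranclp_induct)
    case (step p q)
    have "(adj ?T)\<^sup>*\<^sup>* (False ## p) (False ## q)"
      using step.hyps(2) lift adj_rtranclp_sym by (auto simp: adj_def step_def)
    with step.IH show ?case by simp
  qed simp
  then show ?case
    using head[of x' c] head[OF y', of d] adj_rtranclp_sym unfolding xy
    by (meson rtranclp_trans tail_class_self)
qed

lemma basilica_orbit_eq: "basilica_orbit \<xi> = {x. step\<^sup>*\<^sup>* \<xi> x}"
proof
  have bij: "act s \<in> Bij UNIV" for s
    using act_in_carrier by (auto simp: BijGroup_def)
  have inv: "inv\<^bsub>BijGroup UNIV\<^esub> act s = act_inv s" for s
  proof -
    have "inv_into UNIV (act s) y = act_inv s y" for y
      by (rule inv_into_f_eq) (auto simp: act_inv_right inj_def act_eq_iff)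
    then show ?thesis
      by (simp add: inv_BijGroup[OF bij] fun_eq_iff)
  qed
  have gens: "g \<in> Bij UNIV \<and> (\<forall>x. step\<^sup>*\<^sup>* x (g x))"
    if "g \<in> generate (BijGroup UNIV) (range act)" for g
    using that
  proof (induction rule: generate.induct)
    case one
    show ?case by (auto simp: BijGroup_def Bij_def bij_betw_def)
  next
    case (incl h)
    then show ?case using bij by auto
  next
    case (inv h)
    then obtain s where h: "h = act s" by auto
    have "act_inv s \<in> Bij UNIV"
      unfolding Bij_def by (auto intro!: o_bij[of "act s"] simp: fun_eq_iff act_inv_left act_inv_right)
    then show ?case using inv h by (simp add: \<open>\<And>s. inv\<^bsub>BijGroup UNIV\<^esub> act s = act_inv s\<close> r_into_rtranclp)
  next
    case (eng h1 h2)
    then have "h1 \<otimes>\<^bsub>BijGroup UNIV\<^esub> h2 = compose UNIV h1 h2"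
      by (simp add: BijGroup_def)
    moreover have "step\<^sup>*\<^sup>* x (compose UNIV h1 h2 x)" for x
      using eng rtranclp_trans[of step x "h2 x"] by (simp add: compose_def)
    ultimately show ?case using eng by (simp add: compose_Bij)
  qed
  show "basilica_orbit \<xi> \<subseteq> {x. step\<^sup>*\<^sup>* \<xi> x}"
    using gens by (auto simp: basilica_orbit_def orbit_def basilica_def)
  show "{x. step\<^sup>*\<^sup>* \<xi> x} \<subseteq> basilica_orbit \<xi>"
  proof clarify
    fix x assume "step\<^sup>*\<^sup>* \<xi> x"
    then have "\<exists>g\<in>generate (BijGroup UNIV) (range act). x = g \<xi>"
    proof (induction rule: rtranclp_induct)
      case base
      have "(\<lambda>x\<in>UNIV. x) \<in> generate (BijGroup UNIV) (range act)"
        using generate.one[of "BijGroup UNIV" "range act"] by (simp add: BijGroup_def)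
      then show ?case by (rule bexI[rotated]) simp
    next
      case (step y z)
      then obtain g where g: "g \<in> generate (BijGroup UNIV) (range act)" "y = g \<xi>" by blast
      from step.hyps(2) obtain s where "z = act s y \<or> z = act_inv s y"
        by (metis act_inv_left step_def)
      moreover have "act s \<in> generate (BijGroup UNIV) (range act)"
        "act_inv s \<in> generate (BijGroup UNIV) (range act)"
        using generate.incl[of "act s" "range act" "BijGroup UNIV"]
          generate.inv[of "act s" "range act" "BijGroup UNIV"] by (auto simp: inv)
      moreover have "h g' = (h' \<otimes>\<^bsub>BijGroup UNIV\<^esub> g) \<xi>"
        if "h' \<in> Bij UNIV" "h = h'" "g' = g \<xi>" for h h' g'
        using that gens[OF g(1)] by (simp add: BijGroup_def compose_def)
      ultimately show ?case
        using g gens by (metis generate.eng)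
    qed
    then show "x \<in> basilica_orbit \<xi>"
      by (auto simp: basilica_orbit_def orbit_def basilica_def)
  qed
qed

lemma orbit_self [simp]: "\<xi> \<in> basilica_orbit \<xi>"
  by (simp add: basilica_orbit_eq)

lemma step_rtranclp_sym: "step\<^sup>*\<^sup>* x y \<Longrightarrow> step\<^sup>*\<^sup>* y x"
  by (induction rule: rtranclp_induct) (auto dest: step_sym intro: converse_rtranclp_into_rtranclp)

lemma orbit_eq: "x \<in> basilica_orbit \<xi> \<Longrightarrow> basilica_orbit x = basilica_orbit \<xi>"
proof -
  assume "x \<in> basilica_orbit \<xi>"
  then have "step\<^sup>*\<^sup>* \<xi> x" "step\<^sup>*\<^sup>* x \<xi>"
    by (simp_all add: basilica_orbit_eq step_rtranclp_sym)
  then show ?thesis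
    unfolding basilica_orbit_eq by (blast intro: rtranclp_trans)
qed

lemma orbit_step: "x \<in> basilica_orbit \<xi> \<Longrightarrow> step x y \<Longrightarrow> y \<in> basilica_orbit \<xi>"
  by (auto simp: basilica_orbit_eq)

lemma orbit_tail_class: "x \<in> basilica_orbit \<xi> \<Longrightarrow> tail_class n x \<subseteq> basilica_orbit \<xi>"
  using tail_class_connected adj_rtranclp_step unfolding basilica_orbit_eq
  by (blast intro: rtranclp_trans)

lemma cofinal_words_iff: "cofinal_words x y \<longleftrightarrow> (\<exists>n. y \<in> tail_class n x)"
proof
  assume "cofinal_words x y"
  then obtain n where "\<And>i. x !! i \<noteq> y !! i \<Longrightarrow> i < n"
    by (auto simp: cofinal_words_def finite_nat_set_iff_bounded)
  then have "y \<in> tail_class n x"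
    unfolding tail_class_def using leD by blast
  then show "\<exists>n. y \<in> tail_class n x" ..
next
  assume "\<exists>n. y \<in> tail_class n x"
  then obtain n where "\<And>i. n \<le> i \<Longrightarrow> y !! i = x !! i"
    by (auto simp: tail_class_def)
  then have "i < n" if "x !! i \<noteq> y !! i" for i
    using that not_less by blast
  then have "{i. x !! i \<noteq> y !! i} \<subseteq> {..<n}"
    by auto
  then show "cofinal_words x y"
    unfolding cofinal_words_def using finite_subset by blast
qed

lemma cofinal_refl [simp]: "cofinal_words x x"
  by (simp add: cofinal_words_def)

lemma cofinal_sym: "cofinal_words x y \<Longrightarrow> cofinal_words y x"
  by (simp add: cofinal_words_def eq_commute)

lemma cofinal_trans: "cofinal_words x y \<Longrightarrow> cofinal_words y z \<Longrightarrow> cofinal_words x z"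
  unfolding cofinal_words_def by (rule finite_subset[of _ "{n. x !! n \<noteq> y !! n} \<union> {n. y !! n \<noteq> z !! n}"]) auto

lemma cofinal_in_orbit: "cofinal_words x y \<Longrightarrow> y \<in> basilica_orbit x"
  by (meson cofinal_words_iff orbit_self orbit_tail_class subsetD)

lemma cofinal_act: "x !! j \<Longrightarrow> cofinal_words x (act s x)"
  unfolding cofinal_words_iff tail_class_def
  by (rule exI[of _ "Suc j"]) (auto simp: act_snth_after_one Suc_le_eq)

section \<open>The axis, the retraction onto it and the mirror map\<close>

text \<open>Those of these words that lie in a given 2-ended graph form a bi-infinite path along which \<open>s\<close> moves by
  one step, or there are none of them.\<close>

definition axis :: "generator \<Rightarrow> word set" where
  "axis s = {x. \<forall>i. x !! i \<longrightarrow> flips s i}"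

definition on_axis_from :: "generator \<Rightarrow> word \<Rightarrow> nat \<Rightarrow> bool" where
  "on_axis_from s x j \<longleftrightarrow> (\<forall>i\<ge>j. x !! i \<longrightarrow> flips s i)"

text \<open>If \<open>x\<close> has 1s at positions that are not digits of \<open>s\<close>, but only finitely many, all letters up to the
  last of these are set to 0. The result is the vertex of the axis at which the finite piece containing
  \<open>x\<close> hangs. A word with infinitely many such 1s is sent to \<open>0\<^sup>\<omega>\<close>, and \<open>mirror s\<close> fixes it.\<close>

definition retract :: "generator \<Rightarrow> word \<Rightarrow> word" where
  "retract s x = smap (\<lambda>j. x !! j \<and> on_axis_from s x j) nats"

text \<open>On the axis this is the negation of 2-adic integers: the digits after the lowest 1 are complemented.
  Elsewhere the same digits are complemented as at the point of the axis below, so that the pieces that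
  hang at the axis are carried over as they are.\<close>

definition mirror :: "generator \<Rightarrow> word \<Rightarrow> word" where
  "mirror s x = smap (\<lambda>j. x !! j \<noteq> (flips s j \<and> \<not> zero_below j (retract s x))) nats"

lemma retract_snth: "retract s x !! j \<longleftrightarrow> x !! j \<and> on_axis_from s x j"
  by (simp add: retract_def)

lemma mirror_snth:
  "mirror s x !! j \<longleftrightarrow> x !! j \<noteq> (flips s j \<and> \<not> zero_below j (retract s x))"
  by (simp add: mirror_def)

lemma retract_in_axis [simp]: "retract s x \<in> axis s"
  by (auto simp: axis_def retract_snth on_axis_from_def)

lemma retract_axis: "x \<in> axis s \<Longrightarrow> retract s x = x"
  by (rule word_eqI) (auto simp: axis_def retract_snth on_axis_from_def)

lemma act_axis_iff: "act s x \<in> axis s \<longleftrightarrow> x \<in> axis s"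
  by (auto simp: axis_def act_snth)

lemma act_inv_axis: "x \<in> axis s \<Longrightarrow> act_inv s x \<in> axis s"
  by (metis act_axis_iff act_inv_right)

lemma act_pow_axis: "x \<in> axis s \<Longrightarrow> (act s ^^ n) x \<in> axis s"
  by (induction n) (auto simp: act_axis_iff)

text \<open>Only the \<open>s\<close>-edges between points of the axis lead from one fibre of the retraction to another: an \<open>s\<close>-edge
  elsewhere keeps the letters off the digits of \<open>s\<close>, hence the length of the erased prefix, and an
  edge of the other generator alters this length only where the digits of \<open>s\<close> are 0 anyway.\<close>

lemma retract_act:
  assumes "t \<noteq> s \<or> x \<notin> axis s"
  shows "retract s (act t x) = retract s x"
proof (rule word_eqI)
  fix j
  have later: "on_axis_from s (act t x) j \<longleftrightarrow> on_axis_from s x j" if "x !! j" "flips s j"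
    using that by (auto simp: on_axis_from_def le_less act_snth_after_one)
  show "retract s (act t x) !! j = retract s x !! j"
  proof (cases "flips s j")
    case False
    then show ?thesis by (auto simp: retract_snth on_axis_from_def)
  next
    case True
    show ?thesis
    proof (cases "t = s")
      case False
      then have "act t x !! j = x !! j"
        using True flips_other[of s t j] by (simp add: act_snth)
      then show ?thesis
        using later True by (auto simp: retract_snth)
    next
      case t: True
      then obtain i where i: "x !! i" "\<not> flips s i"
        using assms by (auto simp: axis_def)
      then have i': "act t x !! i"
        by (simp add: t act_snth)
      show ?thesis
      proof (cases "i < j")
        case True
        then have "act t x !! k = x !! k" if "k \<ge> j" for k
          using act_snth_after_one[OF i(1)] that by auto
        then show ?thesis
          by (auto simp: retract_snth on_axis_from_def)
      next
        case False
        then show ?thesis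
          using i i' by (auto simp: retract_snth on_axis_from_def not_less)
      qed
    qed
  qed
qed

lemma zero_below_retract: "zero_below j x \<Longrightarrow> zero_below j (retract s x)"
  by (simp add: zero_below_def retract_snth)

lemma zero_below_mirror [simp]: "zero_below j (mirror s x) \<longleftrightarrow> zero_below j x"
  by (induction j) (auto simp: zero_below_Suc mirror_snth zero_below_retract)

lemma zero_below_retract_mirror:
  "zero_below j (retract s (mirror s x)) \<longleftrightarrow> zero_below j (retract s x)"
proof (induction j)
  case (Suc j)
  have "on_axis_from s (mirror s x) j \<longleftrightarrow> on_axis_from s x j"
    by (auto simp: on_axis_from_def mirror_snth)
  then show ?case
    using Suc by (auto simp: zero_below_Suc retract_snth mirror_snth)
qed simp

lemma mirror_mirror [simp]: "mirror s (mirror s x) = x"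
  by (rule word_eqI) (auto simp: mirror_snth zero_below_retract_mirror)

lemma mirror_axis_iff [simp]: "mirror s x \<in> axis s \<longleftrightarrow> x \<in> axis s"
  by (auto simp: axis_def mirror_snth)

lemma mirror_act_off_axis:
  assumes "t \<noteq> s \<or> x \<notin> axis s"
  shows "mirror s (act t x) = act t (mirror s x)"
  by (rule word_eqI) (auto simp: mirror_snth act_snth retract_act[OF assms])

text \<open>In 2-adic terms: \<open>-(x - 1) - 1 = -x\<close>.\<close>

lemma mirror_act_axis:
  assumes "x \<in> axis s"
  shows "act s (mirror s (act s x)) = mirror s x"
  using assms act_axis_iff[of s x]
  by (intro word_eqI) (auto simp: mirror_snth act_snth retract_axis)

lemma step_mirror: "step x y \<Longrightarrow> step (mirror s x) (mirror s y)"
  unfolding step_def by (metis mirror_act_axis mirror_act_off_axis)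

lemma mirror_orbit: "x \<in> basilica_orbit \<xi> \<Longrightarrow> mirror s x \<in> basilica_orbit (mirror s \<xi>)"
  unfolding basilica_orbit_eq mem_Collect_eq
  by (induction rule: rtranclp_induct) (auto intro: rtranclp.rtrancl_into_rtrancl step_mirror)

lemma schreier_graph_simps [simp]:
  "verts (schreier_graph \<xi>) = basilica_orbit \<xi>"
  "edges (schreier_graph \<xi>) = basilica_orbit \<xi> \<times> UNIV"
  "endpoints (schreier_graph \<xi>) (x, s) = Upair x (act s x)"
  by (simp_all add: schreier_graph_def)

text \<open>The mirror map reverses the \<open>s\<close>-edges of the axis and respects the direction of all other edges. As
  the edge \<open>(x, s)\<close> is named after its source, a reversed edge is named after the image of its target.\<close>

lemma schreier_graph_mirror_iso:
  "multigraph_iso (schreier_graph \<xi>) (schreier_graph (mirror s \<xi>))"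
proof -
  define g where "g = (\<lambda>(x, t). if t = s \<and> x \<in> axis s then (mirror s (act s x), s) else (mirror s x, t))"
  have g_g: "g (g e) = e" for e
  proof (cases e)
    case (Pair x t)
    have "mirror s (act s (mirror s (act s x))) = x" if "x \<in> axis s"
      using that by (simp add: mirror_act_axis)
    then show ?thesis
      by (auto simp: g_def Pair act_axis_iff)
  qed
  have g_edges: "g e \<in> basilica_orbit (mirror s \<xi>) \<times> UNIV"
    if "e \<in> basilica_orbit \<xi> \<times> UNIV" for e \<xi>
    using that mirror_orbit orbit_step[OF _ step_act(1)] by (auto simp: g_def)
  show ?thesis
    unfolding multigraph_iso_def
  proof (intro exI conjI ballI)
    show "bij_betw (mirror s) (verts (schreier_graph \<xi>)) (verts (schreier_graph (mirror s \<xi>)))"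
      using mirror_orbit[of _ "mirror s \<xi>" s] mirror_orbit[of _ \<xi> s]
      by (intro bij_betw_byWitness[of _ "mirror s"]) auto
    show "bij_betw g (edges (schreier_graph \<xi>)) (edges (schreier_graph (mirror s \<xi>)))"
      unfolding schreier_graph_simps
      by (rule bij_betw_byWitness[of _ g])
        (use g_g g_edges[of _ \<xi>] g_edges[of _ "mirror s \<xi>", unfolded mirror_mirror] in blast)+
    fix e assume "e \<in> edges (schreier_graph \<xi>)"
    show "endpoints (schreier_graph (mirror s \<xi>)) (g e) =
        map_uprod (mirror s) (endpoints (schreier_graph \<xi>) e)"
    proof (cases e)
      case (Pair x t)
      show ?thesis
        using mirror_act_axis[of x s] mirror_act_off_axis[of t s x]
        by (auto simp: Pair g_def)
    qed
  qed
qed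

section \<open>Isomorphisms and the number of ends\<close>

text \<open>The effect of an isomorphism of multigraphs on the vertices; multiplicities of edges are forgotten.\<close>

definition schreier_map :: "word \<Rightarrow> word \<Rightarrow> (word \<Rightarrow> word) \<Rightarrow> bool" where
  "schreier_map \<xi> \<eta> f \<longleftrightarrow> bij_betw f (basilica_orbit \<xi>) (basilica_orbit \<eta>) \<and>
     (\<forall>x\<in>basilica_orbit \<xi>. \<forall>y\<in>basilica_orbit \<xi>. step (f x) (f y) \<longleftrightarrow> step x y)"

lemma step_iff_edge:
  assumes "x \<in> basilica_orbit \<xi>" "y \<in> basilica_orbit \<xi>"
  shows "step x y \<longleftrightarrow>
    (\<exists>e\<in>edges (schreier_graph \<xi>). endpoints (schreier_graph \<xi>) e = Upair x y)"
  using assms by (force simp: step_def)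

lemma adjacent_off_schreier:
  "adjacent_off (schreier_graph \<xi>) K = adj (basilica_orbit \<xi> - K)"
proof (intro ext)
  fix x y
  show "adjacent_off (schreier_graph \<xi>) K x y = adj (basilica_orbit \<xi> - K) x y"
    using step_iff_edge[of x \<xi> y] unfolding adjacent_off_def adj_def by auto
qed

lemma multigraph_iso_imp_schreier_map:
  assumes "multigraph_iso (schreier_graph \<xi>) (schreier_graph \<eta>)"
  shows "\<exists>f. schreier_map \<xi> \<eta> f"
proof -
  let ?G = "schreier_graph \<xi>" and ?H = "schreier_graph \<eta>"
  obtain f g where f: "bij_betw f (basilica_orbit \<xi>) (basilica_orbit \<eta>)"
    and g: "bij_betw g (edges ?G) (edges ?H)"
    and fg: "\<And>e. e \<in> edges ?G \<Longrightarrow> endpoints ?H (g e) = map_uprod f (endpoints ?G e)"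
    using assms unfolding multigraph_iso_def schreier_graph_simps(1) by blast
  have "step (f x) (f y) \<longleftrightarrow> step x y"
    if x: "x \<in> basilica_orbit \<xi>" and y: "y \<in> basilica_orbit \<xi>" for x y
  proof
    assume "step x y"
    then obtain e where e: "e \<in> edges ?G" "endpoints ?G e = Upair x y"
      using step_iff_edge[OF x y] by blast
    then have "g e \<in> edges ?H" "endpoints ?H (g e) = Upair (f x) (f y)"
      using g fg[OF e(1)] by (auto dest: bij_betwE)
    then show "step (f x) (f y)"
      using step_iff_edge[of "f x" \<eta> "f y"] f x y by (blast dest: bij_betwE)
  next
    assume "step (f x) (f y)"
    then obtain e' where "e' \<in> edges ?H" "endpoints ?H e' = Upair (f x) (f y)"
      using step_iff_edge[of "f x" \<eta> "f y"] f x y by (blast dest: bij_betwE)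
    then obtain e where e: "e \<in> edges ?G" "map_uprod f (endpoints ?G e) = Upair (f x) (f y)"
      using g fg unfolding bij_betw_def by (metis imageE)
    obtain z t where z: "e = (z, t)" by (cases e)
    have zo: "z \<in> basilica_orbit \<xi>" "act t z \<in> basilica_orbit \<xi>"
      using e(1) orbit_step step_act(1) by (auto simp: z)
    have "f z = f x \<and> f (act t z) = f y \<or> f z = f y \<and> f (act t z) = f x"
      using e(2) by (simp add: z)
    moreover have "inj_on f (basilica_orbit \<xi>)"
      using f by (simp add: bij_betw_def)
    ultimately have "z = x \<and> act t z = y \<or> z = y \<and> act t z = x"
      using zo x y by (meson inj_onD)
    then show "step x y"
      by (auto simp: step_def)
  qed
  then show ?thesis
    using f unfolding schreier_map_def by blast
qed

context
  fixes \<xi> \<eta> :: word and f :: "word \<Rightarrow> word"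
  assumes f: "schreier_map \<xi> \<eta> f"
begin

lemma schreier_map_inj: "x \<in> basilica_orbit \<xi> \<Longrightarrow> y \<in> basilica_orbit \<xi> \<Longrightarrow> f x = f y \<longleftrightarrow> x = y"
  using f by (auto simp: schreier_map_def bij_betw_def inj_on_def)

lemma schreier_map_in: "x \<in> basilica_orbit \<xi> \<Longrightarrow> f x \<in> basilica_orbit \<eta>"
  using f by (auto simp: schreier_map_def bij_betw_def)

lemma schreier_map_step:
  "x \<in> basilica_orbit \<xi> \<Longrightarrow> y \<in> basilica_orbit \<xi> \<Longrightarrow> step (f x) (f y) \<longleftrightarrow> step x y"
  using f by (auto simp: schreier_map_def)

lemma schreier_map_obtain_inverse:
  obtains g where "schreier_map \<eta> \<xi> g" "\<And>x. x \<in> basilica_orbit \<xi> \<Longrightarrow> g (f x) = x"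
    "\<And>y. y \<in> basilica_orbit \<eta> \<Longrightarrow> f (g y) = y"
proof
  let ?g = "inv_into (basilica_orbit \<xi>) f"
  have bij: "bij_betw f (basilica_orbit \<xi>) (basilica_orbit \<eta>)"
    using f by (simp add: schreier_map_def)
  show gf: "?g (f x) = x" if "x \<in> basilica_orbit \<xi>" for x
    using bij that by (simp add: bij_betw_inv_into_left)
  show fg: "f (?g y) = y" if "y \<in> basilica_orbit \<eta>" for y
    using bij that by (simp add: bij_betw_inv_into_right)
  have g: "bij_betw ?g (basilica_orbit \<eta>) (basilica_orbit \<xi>)"
    by (rule bij_betw_inv_into[OF bij])
  have "step (?g x) (?g y) \<longleftrightarrow> step x y"
    if "x \<in> basilica_orbit \<eta>" "y \<in> basilica_orbit \<eta>" for x y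
    using schreier_map_step[of "?g x" "?g y"] that fg bij_betwE[OF g] by simp
  with g show "schreier_map \<eta> \<xi> ?g"
    by (simp add: schreier_map_def)
qed

lemma schreier_map_path:
  assumes "(adj S)\<^sup>*\<^sup>* x y" "S \<subseteq> basilica_orbit \<xi>"
  shows "(adj (f ` S))\<^sup>*\<^sup>* (f x) (f y)"
  using assms(1)
proof (induction rule: rtranclp_induct)
  case (step y z)
  then have "adj (f ` S) (f y) (f z)"
    using assms(2) schreier_map_step[of y z] by (auto simp: adj_def)
  with step.IH show ?case by (rule rtranclp.rtrancl_into_rtrancl)
qed simp

lemma schreier_map_ray:
  assumes "r \<in> rays (schreier_graph \<xi>)"
  shows "f \<circ> r \<in> rays (schreier_graph \<eta>)"
proof -
  have r: "r i \<in> basilica_orbit \<xi>" "step (r i) (r (Suc i))" for i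
    using assms by (auto simp: rays_def adjacent_off_schreier adj_def)
  have "inj (f \<circ> r)"
    using assms r(1) schreier_map_inj by (auto simp: rays_def inj_def)
  then show ?thesis
    using r schreier_map_in schreier_map_step
    by (auto simp: rays_def adjacent_off_schreier adj_def)
qed

lemma schreier_map_ray_equiv:
  assumes "(r, r') \<in> ray_equiv (schreier_graph \<xi>)"
  shows "(f \<circ> r, f \<circ> r') \<in> ray_equiv (schreier_graph \<eta>)"
proof -
  obtain g where gf: "\<And>x. x \<in> basilica_orbit \<xi> \<Longrightarrow> g (f x) = x"
    using schreier_map_obtain_inverse by metis
  have rays: "r \<in> rays (schreier_graph \<xi>)" "r' \<in> rays (schreier_graph \<xi>)"
    using assms by (auto simp: ray_equiv_def)
  have "\<exists>N. \<forall>m\<ge>N. \<forall>n\<ge>N. (f \<circ> r) m \<notin> K \<and> (f \<circ> r') n \<notin> K \<and>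
      (adj (basilica_orbit \<eta> - K))\<^sup>*\<^sup>* ((f \<circ> r) m) ((f \<circ> r') n)" if "finite K" for K
  proof -
    have "finite (g ` K)" using that by simp
    then obtain N where N: "\<And>m n. m \<ge> N \<Longrightarrow> n \<ge> N \<Longrightarrow> r m \<notin> g ` K \<and> r' n \<notin> g ` K \<and>
        (adj (basilica_orbit \<xi> - g ` K))\<^sup>*\<^sup>* (r m) (r' n)"
      using assms by (simp add: ray_equiv_def adjacent_off_schreier) meson
    have in_orbit: "r i \<in> basilica_orbit \<xi>" "r' i \<in> basilica_orbit \<xi>" for i
      using rays by (auto simp: rays_def adjacent_off_schreier adj_def)
    have off: "f x \<notin> K" if "x \<in> basilica_orbit \<xi>" "x \<notin> g ` K" for x
      using gf[OF that(1)] that(2) by force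
    have "f ` (basilica_orbit \<xi> - g ` K) \<subseteq> basilica_orbit \<eta> - K"
      using off schreier_map_in by auto
    then have "(f \<circ> r) m \<notin> K \<and> (f \<circ> r') n \<notin> K \<and>
        (adj (basilica_orbit \<eta> - K))\<^sup>*\<^sup>* ((f \<circ> r) m) ((f \<circ> r') n)" if "m \<ge> N" "n \<ge> N" for m n
      using N[OF that] off in_orbit
        adj_rtranclp_mono[OF _ schreier_map_path[of "basilica_orbit \<xi> - g ` K" "r m" "r' n"]]
      by simp
    then show ?thesis by blast
  qed
  then show ?thesis
    using rays schreier_map_ray by (simp add: ray_equiv_def adjacent_off_schreier)
qed

end

lemma schreier_map_card_ends:
  assumes f: "schreier_map \<xi> \<eta> f"
  shows "card (graph_ends (schreier_graph \<eta>)) = card (graph_ends (schreier_graph \<xi>))"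
proof -
  let ?R = "rays (schreier_graph \<xi>)" and ?E = "ray_equiv (schreier_graph \<xi>)"
  let ?R' = "rays (schreier_graph \<eta>)" and ?E' = "ray_equiv (schreier_graph \<eta>)"
  obtain g where g: "schreier_map \<eta> \<xi> g"
    and gf: "\<And>x. x \<in> basilica_orbit \<xi> \<Longrightarrow> g (f x) = x"
    and fg: "\<And>y. y \<in> basilica_orbit \<eta> \<Longrightarrow> f (g y) = y"
    using schreier_map_obtain_inverse[OF f] by metis
  define F where "F = (\<lambda>r :: nat \<Rightarrow> word. f \<circ> r)"
  have in_orbit: "r i \<in> basilica_orbit \<zeta>" if "r \<in> rays (schreier_graph \<zeta>)" for r i \<zeta>
    using that by (auto simp: rays_def adjacent_off_schreier adj_def)
  have gF: "g \<circ> F r = r" if "r \<in> ?R" for r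
    using in_orbit[OF that] gf by (auto simp: F_def fun_eq_iff)
  have Fg: "F (g \<circ> r) = r" if "r \<in> ?R'" for r
    using in_orbit[OF that] fg by (auto simp: F_def fun_eq_iff)
  have inj: "inj_on F ?R"
    by (metis gF inj_onI)
  have class_eq: "F ` (?E `` {r}) = ?E' `` {F r}" if "r \<in> ?R" for r
  proof
    show "F ` (?E `` {r}) \<subseteq> ?E' `` {F r}"
      using schreier_map_ray_equiv[OF f] by (auto simp: F_def)
    show "?E' `` {F r} \<subseteq> F ` (?E `` {r})"
    proof
      fix r' assume "r' \<in> ?E' `` {F r}"
      then have "r' \<in> ?R'" "(g \<circ> F r, g \<circ> r') \<in> ?E"
        using schreier_map_ray_equiv[OF g] by (auto simp: ray_equiv_def)
      then show "r' \<in> F ` (?E `` {r})"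
        using gF[OF that] Fg by (metis Image_singleton_iff imageI)
    qed
  qed
  have quotient_eq: "A // E = (\<lambda>r. E `` {r}) ` A" for A :: "(nat \<Rightarrow> word) set" and E
    by (auto simp: quotient_def)
  have "F ` ?R = ?R'"
  proof
    show "F ` ?R \<subseteq> ?R'"
      using schreier_map_ray[OF f] by (auto simp: F_def)
    show "?R' \<subseteq> F ` ?R"
      using schreier_map_ray[OF g] Fg by (metis imageI subsetI)
  qed
  then have "?R' // ?E' = (\<lambda>r. ?E' `` {F r}) ` ?R"
    by (simp add: quotient_eq image_image flip: \<open>F ` ?R = ?R'\<close>)
  also have "\<dots> = (`) F ` (?R // ?E)"
    using class_eq by (simp add: quotient_eq image_image)
  finally have "?R' // ?E' = (`) F ` (?R // ?E)" .
  moreover have "inj_on ((`) F) (?R // ?E)"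
  proof (rule inj_onI)
    fix X Y assume XY: "X \<in> ?R // ?E" "Y \<in> ?R // ?E" "F ` X = F ` Y"
    then have "X \<subseteq> ?R" "Y \<subseteq> ?R"
      by (auto simp: quotient_def ray_equiv_def)
    then show "X = Y"
      using inj XY(3) by (metis inj_on_image_eq_iff)
  qed
  ultimately show ?thesis
    by (simp add: graph_ends_def card_image)
qed

section \<open>Words whose graph does not have two ends\<close>

definition zeros :: word where
  "zeros = sconst False"

lemma snth_zeros [simp]: "\<not> zeros !! i"
  by (simp add: zeros_def)

lemma neq_zeros_iff: "x \<noteq> zeros \<longleftrightarrow> (\<exists>i. x !! i)"
  by (metis snth_zeros word_eqI)

lemma infinite_flips: "infinite {i. flips s i}"
proof -
  have "\<exists>i>m. flips s i" for m
    by (meson flips_Suc less_Suc_eq)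
  then show ?thesis
    unfolding infinite_nat_iff_unbounded by auto
qed

lemma cofinal_finite_iff:
  assumes "cofinal_words x y"
  shows "finite {i. Q (x !! i) i} \<longleftrightarrow> finite {i. Q (y !! i) i}"
proof -
  have *: "finite {i. Q (b !! i) i}"
    if "cofinal_words a b" "finite {i. Q (a !! i) i}" for a b
  proof (rule finite_subset)
    show "{i. Q (b !! i) i} \<subseteq> {i. Q (a !! i) i} \<union> {i. a !! i \<noteq> b !! i}"
    proof
      fix i assume "i \<in> {i. Q (b !! i) i}"
      then show "i \<in> {i. Q (a !! i) i} \<union> {i. a !! i \<noteq> b !! i}"
        by (cases "a !! i = b !! i") auto
    qed
    show "finite ({i. Q (a !! i) i} \<union> {i. a !! i \<noteq> b !! i})"
      using that unfolding cofinal_words_def by blast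
  qed
  show ?thesis
    using *[OF assms] *[OF cofinal_sym[OF assms]] by blast
qed

lemma cofinal_zeros_iff: "cofinal_words zeros x \<longleftrightarrow> finite {i. x !! i}"
  by (simp add: cofinal_words_def)

text \<open>A nonzero word keeps all letters behind its first 1, so only the two edges leaving \<open>0\<^sup>\<omega>\<close> change
  infinitely many letters.\<close>

lemma step_cofinal:
  assumes "step x y" "x \<noteq> zeros" "y \<noteq> zeros"
  shows "cofinal_words x y"
  using assms cofinal_act cofinal_sym unfolding step_def neq_zeros_iff by metis

lemma orbit_eq_cofinal_class:
  assumes "zeros \<notin> basilica_orbit \<xi>"
  shows "basilica_orbit \<xi> = {x. cofinal_words \<xi> x}"
proof
  show "{x. cofinal_words \<xi> x} \<subseteq> basilica_orbit \<xi>"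
    using cofinal_in_orbit by auto
  have "cofinal_words \<xi> x" if "step\<^sup>*\<^sup>* \<xi> x" for x
    using that
  proof (induction rule: rtranclp_induct)
    case (step y z)
    then have "y \<in> basilica_orbit \<xi>" "z \<in> basilica_orbit \<xi>"
      by (auto simp: basilica_orbit_eq)
    then have "cofinal_words y z"
      using step.hyps(2) assms by (intro step_cofinal) auto
    with step.IH show ?case by (rule cofinal_trans)
  qed simp
  then show "basilica_orbit \<xi> \<subseteq> {x. cofinal_words \<xi> x}"
    by (auto simp: basilica_orbit_eq)
qed

lemma rayD:
  assumes "r \<in> rays (schreier_graph \<xi>)"
  shows "r i \<in> basilica_orbit \<xi>" "step (r i) (r (Suc i))" "inj r"
  using assms by (auto simp: rays_def adjacent_off_schreier adj_def)

lemma rayI: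
  assumes "inj r" "\<And>i. r i \<in> basilica_orbit \<xi>" "\<And>i. step (r i) (r (Suc i))"
  shows "r \<in> rays (schreier_graph \<xi>)"
  using assms by (auto simp: rays_def adjacent_off_schreier adj_def)

lemma ray_eventually_off:
  assumes r: "r \<in> rays (schreier_graph \<xi>)" and K: "finite K"
  obtains N where "\<And>m. m \<ge> N \<Longrightarrow> r m \<in> basilica_orbit \<xi> - K"
proof -
  have "finite (r -` K)"
    by (rule finite_vimageI[OF K rayD(3)[OF r]])
  then obtain N where "\<And>m. m \<in> r -` K \<Longrightarrow> m < N"
    by (meson finite_nat_set_iff_bounded)
  then have "r m \<in> basilica_orbit \<xi> - K" if "m \<ge> N" for m
    using that rayD(1)[OF r] leD by blast
  then show ?thesis by (rule that)
qed

lemma ray_equiv_refl: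
  assumes r: "r \<in> rays (schreier_graph \<xi>)"
  shows "(r, r) \<in> ray_equiv (schreier_graph \<xi>)"
proof -
  have "\<exists>N. \<forall>m\<ge>N. \<forall>n\<ge>N. r m \<notin> K \<and> r n \<notin> K \<and> (adj (basilica_orbit \<xi> - K))\<^sup>*\<^sup>* (r m) (r n)"
    if "finite K" for K
  proof -
    let ?A = "(adj (basilica_orbit \<xi> - K))\<^sup>*\<^sup>*"
    obtain N where N: "\<And>m. m \<ge> N \<Longrightarrow> r m \<in> basilica_orbit \<xi> - K"
      using ray_eventually_off[OF r \<open>finite K\<close>] by blast
    have from_N: "?A (r N) (r m)" if "N \<le> m" for m
      using that
    proof (induction m rule: dec_induct)
      case (step m)
      then have "adj (basilica_orbit \<xi> - K) (r m) (r (Suc m))"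
        using N[of m] N[of "Suc m"] rayD(2)[OF r] by (simp add: adj_def)
      with step.IH show ?case by (rule rtranclp.rtrancl_into_rtrancl)
    qed simp
    then have "?A (r m) (r n)" if "m \<ge> N" "n \<ge> N" for m n
      using rtranclp_trans[OF adj_rtranclp_sym] that by blast
    then show ?thesis
      using N by (intro exI[of _ N]) auto
  qed
  then show ?thesis
    using r by (simp add: ray_equiv_def adjacent_off_schreier)
qed

lemma act_pow_act_inv_pow: "(act s ^^ n) ((act_inv s ^^ n) x) = x"
  by (induction n arbitrary: x) (simp_all add: funpow_swap1 act_inv_right)

lemma inj_act_pow:
  assumes "\<And>n. n > 0 \<Longrightarrow> (act s ^^ n) x \<noteq> x"
  shows "inj (\<lambda>n. (act s ^^ n) x)" "inj (\<lambda>n. (act_inv s ^^ n) x)"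
proof -
  have "(act s ^^ i) x \<noteq> (act s ^^ (i + d)) x" if "d > 0" for i d
    using assms[OF that] by (metis act_pow_inject funpow_add o_apply)
  then have less: "(act s ^^ i) x \<noteq> (act s ^^ j) x" if "i < j" for i j
    using that less_imp_add_positive by blast
  then show "inj (\<lambda>n. (act s ^^ n) x)"
    by (metis (lifting) injI nat_neq_iff)
  have "(act_inv s ^^ i) x \<noteq> (act_inv s ^^ j) x" if "i < j" for i j
  proof
    assume eq: "(act_inv s ^^ i) x = (act_inv s ^^ j) x"
    obtain d where d: "d > 0" "j = i + d"
      using \<open>i < j\<close> less_imp_add_positive by blast
    have "x = (act s ^^ (d + i)) ((act_inv s ^^ j) x)"
      using act_pow_act_inv_pow[of j s x] by (simp add: d add.commute)
    also have "\<dots> = (act s ^^ d) x"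
      by (simp only: eq[symmetric] funpow_add o_apply act_pow_act_inv_pow)
    finally show False
      using assms[OF d(1)] by simp
  qed
  then show "inj (\<lambda>n. (act_inv s ^^ n) x)"
    by (metis (lifting) injI nat_neq_iff)
qed

lemma act_zeros_snth: "act s zeros !! i = flips s i"
  by (simp add: act_snth zero_below_def)

lemma act_pow_zeros_cofinal: "cofinal_words (act s zeros) ((act s ^^ Suc n) zeros)"
proof (induction n)
  case (Suc n)
  have "infinite {i. (act s ^^ Suc n) zeros !! i}"
    using cofinal_finite_iff[OF Suc.IH, of "\<lambda>b _. b"] infinite_flips[of s]
    by (simp add: act_zeros_snth)
  then obtain j where "(act s ^^ Suc n) zeros !! j"
    using not_finite_existsD by blast
  then show ?case
    using cofinal_trans[OF Suc.IH cofinal_act] by simp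
qed simp

lemma act_zeros_not_cofinal: "\<not> cofinal_words zeros (act s zeros)"
  using infinite_flips by (simp add: cofinal_zeros_iff act_zeros_snth)

lemma act_inv_pow_zeros_cofinal: "cofinal_words zeros ((act_inv s ^^ n) zeros)"
proof (induction n)
  case (Suc n)
  let ?y = "(act_inv s ^^ n) zeros"
  have "act_inv s ?y \<noteq> zeros"
    using Suc.IH act_zeros_not_cofinal by (metis act_inv_right)
  then obtain j where "act_inv s ?y !! j"
    by (auto simp: neq_zeros_iff)
  then have "cofinal_words (act_inv s ?y) ?y"
    using cofinal_act[of _ _ s] act_inv_right by metis
  then show ?case
    using cofinal_trans[OF Suc.IH cofinal_sym] by simp
qed simp

lemma funpow_Suc_step:
  "step ((act s ^^ n) x) ((act s ^^ Suc n) x)" "step ((act_inv s ^^ n) x) ((act_inv s ^^ Suc n) x)"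
  by simp_all

text \<open>Three rays start next to \<open>0\<^sup>\<omega>\<close>: forwards along \<open>a\<close>, forwards along \<open>b\<close> and backwards along \<open>a\<close>. They run
  in the cofinality classes of \<open>(01)\<^sup>\<omega>\<close>, \<open>(10)\<^sup>\<omega>\<close> and \<open>0\<^sup>\<omega>\<close>. Once \<open>0\<^sup>\<omega>\<close> is deleted, no edge connects
  different classes, so the three rays define three ends.\<close>

lemma zeros_orbit_not_two_ended:
  assumes "zeros \<in> basilica_orbit \<xi>"
  shows "card (graph_ends (schreier_graph \<xi>)) \<noteq> 2"
proof
  assume two: "card (graph_ends (schreier_graph \<xi>)) = 2"
  let ?E = "ray_equiv (schreier_graph \<xi>)"
  define r1 where "r1 = (\<lambda>n. (act Gen_a ^^ Suc n) zeros)"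
  define r2 where "r2 = (\<lambda>n. (act Gen_b ^^ Suc n) zeros)"
  define r3 where "r3 = (\<lambda>n. (act_inv Gen_a ^^ Suc n) zeros)"
  have "(act s ^^ n) zeros \<noteq> zeros" if "n > 0" for s n
    using that act_pow_zeros_cofinal[of s "n - 1"] act_zeros_not_cofinal cofinal_sym
    by (metis Suc_pred')
  note inj = inj_act_pow[OF this]
  have orb: "(act s ^^ n) zeros \<in> basilica_orbit \<xi>" "(act_inv s ^^ n) zeros \<in> basilica_orbit \<xi>" for s n
    using assms orbit_step step_act(1) step_act_inv(1) by (induction n; force)+
  have fwd: "(\<lambda>n. (act s ^^ Suc n) zeros) \<in> rays (schreier_graph \<xi>)" for s
  proof (rule rayI)
    show "inj (\<lambda>n. (act s ^^ Suc n) zeros)"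
      using inj(1)[of s] by (auto simp: inj_def simp del: funpow.simps)
  qed (use orb in \<open>simp_all del: funpow.simps add: funpow_Suc_step\<close>)
  have bwd: "(\<lambda>n. (act_inv s ^^ Suc n) zeros) \<in> rays (schreier_graph \<xi>)" for s
  proof (rule rayI)
    show "inj (\<lambda>n. (act_inv s ^^ Suc n) zeros)"
      using inj(2)[of s] by (auto simp: inj_def simp del: funpow.simps)
  qed (use orb in \<open>simp_all del: funpow.simps add: funpow_Suc_step\<close>)
  \<comment> \<open>Deleting \<open>0\<^sup>\<omega>\<close> leaves only edges between cofinal words.\<close>
  have cof: "cofinal_words (r 0) (r' 0)"
    if "(r, r') \<in> ?E" and r: "\<And>n. cofinal_words (r 0) (r n)" "\<And>n. cofinal_words (r' 0) (r' n)"
    for r r'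
  proof -
    obtain N where "(adj (basilica_orbit \<xi> - {zeros}))\<^sup>*\<^sup>* (r N) (r' N)"
      using \<open>(r, r') \<in> ?E\<close> unfolding ray_equiv_def adjacent_off_schreier by blast
    then have "cofinal_words (r N) (r' N)"
      by (induction rule: rtranclp_induct)
        (auto simp: adj_def dest: step_cofinal intro: cofinal_trans)
    then show ?thesis
      using cofinal_trans[OF cofinal_trans[OF r(1)] cofinal_sym[OF r(2)]] by blast
  qed
  have along: "cofinal_words (r1 0) (r1 n)" "cofinal_words (r2 0) (r2 n)" "cofinal_words zeros (r3 n)" for n
    using act_pow_zeros_cofinal act_inv_pow_zeros_cofinal[of "Suc n"] by (simp_all add: r1_def r2_def r3_def)
  then have along3: "cofinal_words (r3 0) (r3 n)" for n
    using cofinal_trans[OF cofinal_sym] by blast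
  have ne: "\<not> cofinal_words (r1 0) (r2 0)" "\<not> cofinal_words (r1 0) (r3 0)" "\<not> cofinal_words (r2 0) (r3 0)"
  proof -
    have "{n. act Gen_a zeros !! n \<noteq> act Gen_b zeros !! n} = UNIV"
      by (auto simp: act_zeros_snth flips_def)
    then show "\<not> cofinal_words (r1 0) (r2 0)"
      by (simp add: cofinal_words_def r1_def r2_def)
    show "\<not> cofinal_words (r1 0) (r3 0)" "\<not> cofinal_words (r2 0) (r3 0)"
      using act_zeros_not_cofinal cofinal_trans[OF along(3)[of 0] cofinal_sym]
      by (auto simp: r1_def r2_def)
  qed
  have rays: "r1 \<in> rays (schreier_graph \<xi>)" "r2 \<in> rays (schreier_graph \<xi>)" "r3 \<in> rays (schreier_graph \<xi>)"
    using fwd bwd by (simp_all add: r1_def r2_def r3_def)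
  have "?E `` {r} \<noteq> ?E `` {r'}" if "r' \<in> rays (schreier_graph \<xi>)" "(r, r') \<notin> ?E" for r r'
    using ray_equiv_refl[OF that(1)] that(2) by blast
  then have "card {?E `` {r1}, ?E `` {r2}, ?E `` {r3}} = 3"
    using rays ne cof along(1,2) along3 by (metis card_3_iff)
  moreover have "{?E `` {r1}, ?E `` {r2}, ?E `` {r3}} \<subseteq> graph_ends (schreier_graph \<xi>)"
    using rays by (auto simp: graph_ends_def quotient_def)
  moreover have "finite (graph_ends (schreier_graph \<xi>))"
    using two card.infinite by force
  ultimately have "3 \<le> card (graph_ends (schreier_graph \<xi>))"
    using card_mono[of "graph_ends (schreier_graph \<xi>)" "{?E `` {r1}, ?E `` {r2}, ?E `` {r3}}"]
    by simp
  then show False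
    using two by simp
qed

lemma finite_subset_tail_class:
  assumes "finite A" "\<And>x. x \<in> A \<Longrightarrow> cofinal_words \<xi> x"
  shows "\<exists>n. A \<subseteq> tail_class n \<xi>"
  using assms
proof (induction rule: finite_induct)
  case (insert x A)
  then obtain m n where "A \<subseteq> tail_class m \<xi>" "x \<in> tail_class n \<xi>"
    by (meson cofinal_words_iff insertI1 insertI2)
  then have "insert x A \<subseteq> tail_class (max m n) \<xi>"
    by (auto simp: tail_class_def)
  then show ?case by blast
qed simp

text \<open>Let \<open>V\<close> be the set of words that agree with \<open>\<xi>\<close> from position \<open>n\<close> on, and let \<open>s\<close> be the generator
  that has \<open>n\<close> as a digit. As \<open>\<xi>\<close> has the letter 1 at \<open>n\<close>, the only edges between \<open>V\<close> and the rest
  are one \<open>s\<close>-edge that leaves \<open>V\<close> and one \<open>s\<close>-edge that enters it. They lie on one \<open>s\<close>-cycle, which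
  is finite because of the 1 at \<open>p\<close>. The part of this cycle between the two edges avoids \<open>V\<close>
  and joins their outer ends; any path from outside into \<open>V\<close> arrives at one of these ends.\<close>

lemma tail_class_complement_connected:
  assumes n: "\<xi> !! n" "flips s n" and p: "\<xi> !! p" "\<not> flips s p" "n < p"
    and x: "x \<in> basilica_orbit \<xi> - tail_class n \<xi>" and y: "y \<in> basilica_orbit \<xi> - tail_class n \<xi>"
  shows "(adj (basilica_orbit \<xi> - tail_class n \<xi>))\<^sup>*\<^sup>* x y"
proof -
  let ?V = "tail_class n \<xi>"
  let ?A = "(adj (basilica_orbit \<xi> - ?V))\<^sup>*\<^sup>*"
  define e where "e = smap (\<lambda>i. i \<ge> n \<and> \<xi> !! i) nats"
  have e_snth: "e !! i \<longleftrightarrow> i \<ge> n \<and> \<xi> !! i" for i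
    by (simp add: e_def)
  have e_V: "e \<in> ?V"
    by (simp add: tail_class_def e_snth)
  \<comment> \<open>The word \<open>e\<close> is the only one in \<open>V\<close> from which an edge, taken forwards, leaves \<open>V\<close>.\<close>
  have exit_e: "z = e \<and> t = s" if z: "z \<in> ?V" "act t z \<notin> ?V" for z t
  proof -
    obtain i where "i \<ge> n" "act t z !! i \<noteq> \<xi> !! i"
      using z(2) unfolding tail_class_def by blast
    then have i: "i \<ge> n" "act t z !! i \<noteq> z !! i"
      using z(1) by (simp_all add: tail_class_def)
    have "z !! n"
      using z(1) n by (simp add: tail_class_def)
    then have "i = n"
      using i zero_below_snthD by (fastforce simp: act_snth)
    then have "zero_below n z" "flips t n"
      using i by (auto simp: act_snth)
    moreover have "z !! k = e !! k" for k
      using z(1) \<open>zero_below n z\<close>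
      by (cases "n \<le> k") (auto simp: e_snth zero_below_def tail_class_def not_le)
    ultimately show ?thesis
      using n flips_other[of s t n] word_eqI by blast
  qed
  \<comment> \<open>The target of the edge entering \<open>V\<close> is determined, and hence its source.\<close>
  have entry: "t = s \<and> (\<forall>i. act s z !! i \<longleftrightarrow> (if i < n then flips s i else \<xi> !! i))"
    if z: "z \<notin> ?V" "act t z \<in> ?V" for z t
  proof -
    obtain i where "i \<ge> n" "z !! i \<noteq> \<xi> !! i"
      using z(1) unfolding tail_class_def by blast
    then have i: "i \<ge> n" "act t z !! i \<noteq> z !! i"
      using z(2) by (simp_all add: tail_class_def)
    then have zero: "zero_below i z"
      unfolding act_snth by blast
    then have zero_n: "zero_below n z"
      using i(1) by (simp add: zero_below_def)
    have "act t z !! n"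
      using z(2) n by (simp add: tail_class_def)
    then have "flips t n"
      using i zero by (cases "i = n") (auto simp: act_snth zero_below_def)
    then have "t = s"
      using flips_other[of s t n] n by auto
    then show ?thesis
      using z(2) zero_n by (auto simp: tail_class_def act_snth zero_below_def)
  qed
  have orb_e: "(act s ^^ k) e \<in> basilica_orbit \<xi>" for k
    using e_V orbit_tail_class[OF orbit_self] orbit_step step_act(1)
    by (induction k) (auto simp: subset_iff)
  \<comment> \<open>The 1 at \<open>p\<close> is not a digit of \<open>s\<close>, so it stays and protects all later letters.\<close>
  have "(act s ^^ k) e \<in> tail_class (Suc p) e" for k
  proof (induction k)
    case (Suc k)
    have "(act s ^^ k) e !! p" for k
      using p by (induction k) (auto simp: act_snth_fixed e_snth)
    from act_snth_after_one[OF this[of k]] show ?case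
      using Suc by (simp add: tail_class_def)
  qed simp
  then have "finite (range (\<lambda>k. (act s ^^ k) e))"
    by (meson finite_subset finite_tail_class image_subsetI)
  then have "\<not> inj (\<lambda>k. (act s ^^ k) e)"
    using finite_imageD by blast
  then obtain N where N: "N > 0" "(act s ^^ N) e = e"
    using inj_act_pow(1) by blast
  \<comment> \<open>The first return of the \<open>s\<close>-cycle through \<open>e\<close> to \<open>V\<close>; just before it lies
    the outer end \<open>z\<close> of the entering edge.\<close>
  define r where "r = (LEAST r. r > 0 \<and> (act s ^^ r) e \<in> ?V)"
  have r: "r > 0" "(act s ^^ r) e \<in> ?V"
    using LeastI[of "\<lambda>r. r > 0 \<and> (act s ^^ r) e \<in> ?V" N] N e_V by (auto simp: r_def)
  have before_r: "(act s ^^ k) e \<notin> ?V" if "0 < k" "k < r" for k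
    using not_less_Least[of k "\<lambda>r. r > 0 \<and> (act s ^^ r) e \<in> ?V"] that by (auto simp: r_def)
  have arc: "?A (act s e) ((act s ^^ k) e)" if "1 \<le> k" "k < r" for k
    using that
  proof (induction k rule: dec_induct)
    case (step k)
    then have "adj (basilica_orbit \<xi> - ?V) ((act s ^^ k) e) ((act s ^^ Suc k) e)"
      using before_r[of k] before_r[of "Suc k"] orb_e[of k] orb_e[of "Suc k"] by (simp add: adj_def)
    with step show ?case
      by (meson Suc_lessD rtranclp.rtrancl_into_rtrancl)
  qed simp
  define z where "z = (act s ^^ (r - 1)) e"
  have "act s e \<notin> ?V"
    using n by (auto simp: tail_class_def act_snth e_snth zero_below_def)
  then have "r \<noteq> 1"
    using r by auto
  then have z: "z \<notin> ?V" "act s z \<in> ?V" "?A (act s e) z"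
    using r before_r[of "r - 1"] arc[of "r - 1"] funpow.simps(2)[of "r - 1" "act s"]
    by (auto simp: z_def)
  have "y \<in> ?V \<or> ?A y (act s e)" if "step\<^sup>*\<^sup>* y \<xi>" for y
    using that
  proof (induction rule: converse_rtranclp_induct)
    case (step y y')
    have orb: "y \<in> basilica_orbit \<xi>" "y' \<in> basilica_orbit \<xi>"
      using step.hyps step_rtranclp_sym by (auto simp: basilica_orbit_eq intro: converse_rtranclp_into_rtranclp)
    show ?case
    proof (cases "y \<in> ?V")
      case y: False
      show ?thesis
      proof (cases "y' \<in> ?V")
        case True
        from step.hyps(1) consider t where "y' = act t y" | t where "y = act t y'"
          by (auto simp: step_def)
        then show ?thesis
        proof cases
          case 1
          then have "act s y = act s z"
            using entry[of y t] entry[of z s] y True z by (intro word_eqI) auto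
          then show ?thesis
            using z(3) adj_rtranclp_sym by (auto simp: act_eq_iff)
        next
          case 2
          then show ?thesis using exit_e[of y' t] True y by auto
        qed
      next
        case False
        then have "adj (basilica_orbit \<xi> - ?V) y y'"
          using y orb step.hyps(1) by (simp add: adj_def)
        then show ?thesis
          using step.IH False by (meson converse_rtranclp_into_rtranclp)
      qed
    qed simp
  qed simp
  then have "?A y (act s e)" if "y \<in> basilica_orbit \<xi> - ?V" for y
    using that step_rtranclp_sym by (auto simp: basilica_orbit_eq)
  then show ?thesis
    using x y adj_rtranclp_sym rtranclp_trans by meson
qed

text \<open>If both parities carry infinitely many 1s, every finite set lies in a finite set with connected
  complement, so any two rays are equivalent.\<close>

lemma both_parities_infinite_not_two_ended:
  assumes "zeros \<notin> basilica_orbit \<xi>" and inf: "\<And>s. infinite {i. \<xi> !! i \<and> flips s i}"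
  shows "card (graph_ends (schreier_graph \<xi>)) \<noteq> 2"
proof -
  let ?R = "rays (schreier_graph \<xi>)" and ?E = "ray_equiv (schreier_graph \<xi>)"
  have "(r, r') \<in> ?E" if r: "r \<in> ?R" "r' \<in> ?R" for r r'
  proof -
    have "\<exists>N. \<forall>m\<ge>N. \<forall>n\<ge>N. r m \<notin> K \<and> r' n \<notin> K \<and>
        (adj (basilica_orbit \<xi> - K))\<^sup>*\<^sup>* (r m) (r' n)" if K: "finite K" for K
    proof -
      obtain n0 where n0: "K \<inter> basilica_orbit \<xi> \<subseteq> tail_class n0 \<xi>"
      proof -
        have "finite (K \<inter> basilica_orbit \<xi>)"
          using K by simp
        moreover have "cofinal_words \<xi> x" if "x \<in> K \<inter> basilica_orbit \<xi>" for x
          using that orbit_eq_cofinal_class[OF assms(1)] by blast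
        ultimately show ?thesis
          using finite_subset_tail_class that by blast
      qed
      obtain n where n: "n0 < n" "\<xi> !! n"
        using inf[of Gen_a] unfolding infinite_nat_iff_unbounded by blast
      obtain s where s: "flips s n"
        using ex_flips by blast
      obtain p where p: "n < p" "\<xi> !! p" "\<not> flips s p"
        using inf[of "swap_gen s"] unfolding infinite_nat_iff_unbounded by (auto simp: flips_swap_gen)
      let ?V = "tail_class n \<xi>"
      have sub: "basilica_orbit \<xi> - ?V \<subseteq> basilica_orbit \<xi> - K"
        using n0 tail_class_mono[of n0 n \<xi>] n(1) by auto
      obtain N where N: "\<And>m. m \<ge> N \<Longrightarrow> r m \<in> basilica_orbit \<xi> - ?V"
        using ray_eventually_off[OF r(1) finite_tail_class] by blast
      obtain N' where N': "\<And>m. m \<ge> N' \<Longrightarrow> r' m \<in> basilica_orbit \<xi> - ?V"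
        using ray_eventually_off[OF r(2) finite_tail_class] by blast
      have "r k \<notin> K \<and> r' m \<notin> K \<and> (adj (basilica_orbit \<xi> - K))\<^sup>*\<^sup>* (r k) (r' m)"
        if "k \<ge> max N N'" "m \<ge> max N N'" for k m
        using N[of k] N'[of m] that sub
          adj_rtranclp_mono[OF sub tail_class_complement_connected[OF n(2) s p(2,3,1), of "r k" "r' m"]]
        by auto
      then show ?thesis by blast
    qed
    then show ?thesis
      using r by (simp add: ray_equiv_def adjacent_off_schreier)
  qed
  then have "?E `` {r} = ?R" if "r \<in> ?R" for r
    using that by (auto simp: ray_equiv_def)
  then have "graph_ends (schreier_graph \<xi>) \<subseteq> {?R}"
    by (auto simp: graph_ends_def quotient_def)
  then have "card (graph_ends (schreier_graph \<xi>)) \<le> 1"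
    using card_mono[of "{?R}"] by force
  then show ?thesis by simp
qed

text \<open>The words \<open>w0x\<^sub>10x\<^sub>2\<dots>\<close> in which \<open>0\<close> and \<open>1\<close> both occur infinitely often among the \<open>x\<^sub>i\<close>; the latter
  are the digits of \<open>s\<close>. A tail \<open>0\<^sup>\<omega>\<close> or \<open>(01)\<^sup>\<omega>\<close> is thereby excluded: such digits represent an
  ordinary integer, and the orbit contains \<open>0\<^sup>\<omega>\<close>.\<close>

definition two_ended_word :: "generator \<Rightarrow> word \<Rightarrow> bool" where
  "two_ended_word s \<xi> \<longleftrightarrow> finite {i. \<xi> !! i \<and> \<not> flips s i} \<and>
     infinite {i. \<xi> !! i \<and> flips s i} \<and> infinite {i. \<not> \<xi> !! i \<and> flips s i}"

lemma E2_zeros: "\<xi> \<in> E2 \<Longrightarrow> zeros \<notin> basilica_orbit \<xi>"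
  using zeros_orbit_not_two_ended by (auto simp: E2_def)

lemma E2_two_ended_word:
  assumes "\<xi> \<in> E2"
  shows "\<exists>s. two_ended_word s \<xi>"
proof -
  obtain s0 where s0: "finite {i. \<xi> !! i \<and> flips s0 i}"
    using both_parities_infinite_not_two_ended[OF E2_zeros[OF assms]] assms by (auto simp: E2_def)
  define s where "s = swap_gen s0"
  have off: "finite {i. \<xi> !! i \<and> \<not> flips s i}"
    using s0 by (simp add: s_def flips_swap_gen)
  have "infinite {i. \<xi> !! i \<and> flips s i}"
  proof
    assume "finite {i. \<xi> !! i \<and> flips s i}"
    then have "finite ({i. \<xi> !! i \<and> flips s i} \<union> {i. \<xi> !! i \<and> \<not> flips s i})"
      using off by simp
    then have "cofinal_words zeros \<xi>"
      unfolding cofinal_zeros_iff by (rule rev_finite_subset) auto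
    then show False
      using E2_zeros[OF assms] cofinal_in_orbit cofinal_sym by blast
  qed
  moreover have "infinite {i. \<not> \<xi> !! i \<and> flips s i}"
  proof
    assume "finite {i. \<not> \<xi> !! i \<and> flips s i}"
    then have "finite ({i. \<not> \<xi> !! i \<and> flips s i} \<union> {i. \<xi> !! i \<and> \<not> flips s i})"
      using off by simp
    then have "cofinal_words \<xi> (act s zeros)"
      unfolding cofinal_words_def by (rule rev_finite_subset) (auto simp: act_zeros_snth)
    then show False
      using E2_zeros[OF assms] cofinal_in_orbit orbit_step step_act(2) by blast
  qed
  ultimately show ?thesis
    using off unfolding two_ended_word_def by blast
qed

section \<open>The graph of a two-ended word\<close>

lemma two_ended_word_cofinal:
  assumes "cofinal_words x y" "two_ended_word s x"
  shows "two_ended_word s y"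
  using assms cofinal_finite_iff[OF assms(1), of "\<lambda>b i. b \<and> \<not> flips s i"]
    cofinal_finite_iff[OF assms(1), of "\<lambda>b i. b \<and> flips s i"]
    cofinal_finite_iff[OF assms(1), of "\<lambda>b i. \<not> b \<and> flips s i"]
  by (simp add: two_ended_word_def)

lemma two_ended_word_orbit:
  assumes "zeros \<notin> basilica_orbit \<xi>" "two_ended_word s \<xi>" "x \<in> basilica_orbit \<xi>"
  shows "two_ended_word s x"
  using assms orbit_eq_cofinal_class two_ended_word_cofinal by blast

lemma two_ended_word_on_axis_from:
  assumes "two_ended_word s x"
  obtains N where "on_axis_from s x N"
proof -
  obtain N where "\<And>i. x !! i \<Longrightarrow> \<not> flips s i \<Longrightarrow> i < N"
    using assms unfolding two_ended_word_def finite_nat_set_iff_bounded by blast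
  then have "on_axis_from s x N"
    unfolding on_axis_from_def using leD by blast
  then show ?thesis by (rule that)
qed

lemma two_ended_word_later_one:
  assumes "two_ended_word s x"
  obtains i where "i > m" "x !! i" "flips s i"
  using assms unfolding two_ended_word_def infinite_nat_iff_unbounded by blast

lemma on_axis_from_Suc:
  "on_axis_from s x n \<longleftrightarrow> on_axis_from s x (Suc n) \<and> (x !! n \<longrightarrow> flips s n)"
proof -
  have "n \<le> i \<longleftrightarrow> i = n \<or> Suc n \<le> i" for i
    by auto
  then show ?thesis
    by (auto simp: on_axis_from_def)
qed

lemma retract_snth_tail: "on_axis_from s y m \<Longrightarrow> m \<le> k \<Longrightarrow> retract s y !! k = y !! k"
  by (auto simp: retract_snth on_axis_from_def)

lemma retract_tail_class: "on_axis_from s y m \<Longrightarrow> retract s y \<in> tail_class m y"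
  by (simp add: tail_class_def retract_snth_tail)

section \<open>The action along the axis\<close>

text \<open>In 2-adic terms: if \<open>n\<close> is the number with the first digits of \<open>x\<close>, then \<open>x - n\<close> has 0s in their place
  and the digits of \<open>x\<close> afterwards. The same \<open>n\<close> serves all words with these digits.\<close>

lemma act_pow_clear:
  assumes "x \<in> axis s" "y \<in> axis s" "\<forall>j<i. x !! j = y !! j"
  shows "\<exists>n. (\<forall>k. (act s ^^ n) x !! k \<longleftrightarrow> i \<le> k \<and> x !! k) \<and> (\<forall>k. (act s ^^ n) y !! k \<longleftrightarrow> i \<le> k \<and> y !! k)"
  using assms
proof (induction i arbitrary: x y)
  case 0
  then show ?case by (intro exI[of _ 0]) simp
next
  case (Suc i)
  obtain n where n: "\<And>k. (act s ^^ n) x !! k \<longleftrightarrow> i \<le> k \<and> x !! k" "\<And>k. (act s ^^ n) y !! k \<longleftrightarrow> i \<le> k \<and> y !! k"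
    using Suc.IH[of x y] Suc.prems by auto
  show ?case
  proof (cases "x !! i")
    case False
    then show ?thesis
      using n Suc.prems(3) by (intro exI[of _ n]) (metis Suc_leD Suc_leI le_neq_implies_less lessI)
  next
    case True
    then have y: "y !! i" "flips s i"
      using Suc.prems by (auto simp: axis_def)
    \<comment> \<open>With 0s before position \<open>i\<close>, one more application of \<open>s\<close> borrows from the 1 at
      \<open>i\<close> and sets all lower digits to 1, the same in both words; the induction hypothesis clears them again.\<close>
    have val: "act s z' !! k \<longleftrightarrow> (if k < i then flips s k else Suc i \<le> k \<and> z !! k)"
      if "\<And>k. z' !! k \<longleftrightarrow> i \<le> k \<and> z !! k" "z !! i" for z z' k
    proof -
      have "zero_below k z' \<longleftrightarrow> k \<le> i"
        using that zero_below_snthD[of k z' i] by (auto simp: zero_below_def)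
      then show ?thesis
        using that y(2) by (cases k i rule: linorder_cases) (auto simp: act_snth)
    qed
    note x' = val[OF n(1) True] and y' = val[OF n(2) y(1)]
    have "act s ((act s ^^ n) x) \<in> axis s" "act s ((act s ^^ n) y) \<in> axis s"
      using Suc.prems by (simp_all add: act_axis_iff act_pow_axis)
    then obtain m where m: "\<And>k. (act s ^^ m) (act s ((act s ^^ n) x)) !! k \<longleftrightarrow> i \<le> k \<and> act s ((act s ^^ n) x) !! k"
      "\<And>k. (act s ^^ m) (act s ((act s ^^ n) y)) !! k \<longleftrightarrow> i \<le> k \<and> act s ((act s ^^ n) y) !! k"
      using Suc.IH[of "act s ((act s ^^ n) x)" "act s ((act s ^^ n) y)"] x' y' by auto
    have "(act s ^^ (m + Suc n)) z = (act s ^^ m) (act s ((act s ^^ n) z))" for z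
      by (simp only: funpow_add funpow.simps o_apply)
    then show ?thesis
      using m x' y' by (intro exI[of _ "m + Suc n"]) auto
  qed
qed

lemma act_pow_cofinal:
  assumes "infinite {i. x !! i}"
  shows "cofinal_words x ((act s ^^ n) x)"
proof (induction n)
  case (Suc n)
  have "infinite {i. (act s ^^ n) x !! i}"
    using cofinal_finite_iff[OF Suc.IH, of "\<lambda>b _. b"] assms by simp
  then obtain j where "(act s ^^ n) x !! j"
    using not_finite_existsD by blast
  then show ?case
    using cofinal_trans[OF Suc.IH cofinal_act] by simp
qed simp

text \<open>Otherwise the trajectory of \<open>x\<close> is finite, so the first 1s of its members are at bounded positions;
  but by \<open>act_pow_clear\<close> the trajectory contains words that start with arbitrarily many 0s.\<close>

lemma act_pow_axis_neq:
  assumes x: "x \<in> axis s" "infinite {i. x !! i}" and "d > 0"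
  shows "(act s ^^ d) x \<noteq> x"
proof
  assume d: "(act s ^^ d) x = x"
  let ?R = "range (\<lambda>n. (act s ^^ n) x)"
  have "(act s ^^ n) x \<in> (\<lambda>n. (act s ^^ n) x) ` {..<d}" for n
    using funpow_mod_eq[OF d, of n] \<open>d > 0\<close> by (intro image_eqI[of _ _ "n mod d"]) auto
  then have "?R \<subseteq> (\<lambda>n. (act s ^^ n) x) ` {..<d}"
    by blast
  then have fin: "finite ?R"
    by (rule finite_subset) simp
  have "\<exists>j. (act s ^^ n) x !! j" for n
  proof -
    have "infinite {i. (act s ^^ n) x !! i}"
      using cofinal_finite_iff[OF act_pow_cofinal[OF x(2), where n = n and s = s], of "\<lambda>b _. b"] x(2)
      by simp
    then show ?thesis
      using not_finite_existsD by blast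
  qed
  then have "\<exists>p. \<forall>y\<in>?R. y !! p y"
    by (intro bchoice) auto
  then obtain p where p: "\<And>n. (act s ^^ n) x !! p ((act s ^^ n) x)"
    by auto
  define i where "i = Suc (Max (p ` ?R))"
  have "p ((act s ^^ n) x) < i" for n
    using fin by (simp add: i_def less_Suc_eq_le)
  moreover obtain n where "\<And>k. (act s ^^ n) x !! k \<Longrightarrow> i \<le> k"
    using act_pow_clear[OF x(1,1), of i] by auto
  ultimately show False
    using p leD by blast
qed

lemma axis_cofinal_meet:
  assumes "x \<in> axis s" "y \<in> axis s" "cofinal_words x y"
  shows "\<exists>m n. (act s ^^ m) x = (act s ^^ n) y"
proof -
  obtain i where i: "\<And>k. k \<ge> i \<Longrightarrow> y !! k = x !! k"
    using assms(3) by (auto simp: cofinal_words_iff tail_class_def)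
  obtain m where "\<And>k. (act s ^^ m) x !! k \<longleftrightarrow> i \<le> k \<and> x !! k"
    using act_pow_clear[OF assms(1,1), of i] by auto
  moreover obtain n where "\<And>k. (act s ^^ n) y !! k \<longleftrightarrow> i \<le> k \<and> y !! k"
    using act_pow_clear[OF assms(2,2), of i] by auto
  ultimately have "(act s ^^ m) x = (act s ^^ n) y"
    using i by (intro word_eqI) auto
  then show ?thesis by blast
qed

text \<open>Subtract the number formed by the digits before the first difference of \<open>x\<close> and \<open>y\<close>: one of the
  results then has its first 1 at the place of this difference and the other one later.\<close>

lemma axis_eq_from_first_ones:
  assumes "x \<in> axis s" "y \<in> axis s"
    and first: "\<And>n j. zero_below j ((act s ^^ n) x) \<longleftrightarrow> zero_below j ((act s ^^ n) y)"
  shows "x = y"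
proof (rule ccontr)
  assume "x \<noteq> y"
  then obtain i where "x !! i \<noteq> y !! i"
    using word_eqI by blast
  then obtain i where i: "x !! i \<noteq> y !! i" "\<forall>j<i. x !! j = y !! j"
    using exists_least_iff[of "\<lambda>i. x !! i \<noteq> y !! i"] by blast
  obtain n where n: "\<And>k. (act s ^^ n) x !! k \<longleftrightarrow> i \<le> k \<and> x !! k" "\<And>k. (act s ^^ n) y !! k \<longleftrightarrow> i \<le> k \<and> y !! k"
    using act_pow_clear[OF assms(1,2) i(2)] by blast
  have "zero_below (Suc i) ((act s ^^ n) x) \<longleftrightarrow> \<not> x !! i" "zero_below (Suc i) ((act s ^^ n) y) \<longleftrightarrow> \<not> y !! i"
    by (auto simp: zero_below_def n less_Suc_eq)
  then show False
    using first[of "Suc i" n] i(1) by blast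
qed

lemma axis_act_other:
  assumes "x \<in> axis s" "act t x \<in> axis s" "t \<noteq> s"
  shows "act t x = x"
  using assms flips_other[of s t] by (intro word_eqI) (auto simp: axis_def act_snth)

lemma axis_neighbour:
  assumes "x \<in> axis s" "y \<in> axis s" "step x y" "x \<noteq> y"
  shows "y = act s x \<or> x = act s y"
  using assms axis_act_other unfolding step_def by metis

section \<open>Fibres of the retraction\<close>

definition fibre :: "generator \<Rightarrow> word \<Rightarrow> word set" where
  "fibre s x = {y. retract s y = x}"

lemma fibre_self: "x \<in> axis s \<Longrightarrow> x \<in> fibre s x"
  by (simp add: fibre_def retract_axis)

lemma fibre_tail_class:
  assumes "x !! q"
  shows "fibre s x \<subseteq> tail_class q x"
proof
  fix y assume "y \<in> fibre s x"
  then have "retract s y = x" by (simp add: fibre_def)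
  moreover from this assms have "on_axis_from s y q"
    by (auto simp: retract_snth)
  ultimately show "y \<in> tail_class q x"
    using retract_tail_class by (auto simp: tail_class_def)
qed

lemma finite_fibre: "x !! q \<Longrightarrow> finite (fibre s x)"
  by (rule finite_subset[OF fibre_tail_class finite_tail_class])

text \<open>Let \<open>m\<close> be the position of the last 1 of \<open>y\<close> that is not a digit of \<open>s\<close>. The words with the same letters
  from \<open>m\<close> on all lie in the fibre and are connected. Among them is one that is 0 before \<open>m\<close>, and there
  the other generator deletes the 1 at \<open>m\<close> without leaving the fibre.\<close>

lemma fibre_connected:
  assumes "on_axis_from s y N"
  shows "(adj (fibre s (retract s y)))\<^sup>*\<^sup>* y (retract s y)"
  using assms
proof (induction N arbitrary: y)
  case 0
  then have "y \<in> axis s"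
    by (simp add: on_axis_from_def axis_def)
  then show ?case by (simp add: retract_axis)
next
  case (Suc N)
  let ?F = "fibre s (retract s y)"
  show ?case
  proof (cases "y !! N \<and> \<not> flips s N")
    case False
    then have "on_axis_from s y N"
      using Suc.prems on_axis_from_Suc[of s y N] by blast
    then show ?thesis by (rule Suc.IH)
  next
    case True
    have "retract s z !! k = retract s y !! k" if "z \<in> tail_class N y" for z k
    proof (cases "k \<le> N")
      case True
      have "z !! N" using that \<open>y !! N \<and> \<not> flips s N\<close> by (simp add: tail_class_def)
      then show ?thesis
        using True \<open>y !! N \<and> \<not> flips s N\<close> by (auto simp: retract_snth on_axis_from_def)
    next
      case False
      then show ?thesis
        using that by (auto simp: retract_snth on_axis_from_def tail_class_def)
    qed
    then have same: "retract s z = retract s y" if "z \<in> tail_class N y" for z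
      using that by (blast intro: word_eqI)
    then have sub: "tail_class N y \<subseteq> ?F"
      unfolding fibre_def by blast
    define e where "e = smap (\<lambda>i. i \<ge> N \<and> y !! i) nats"
    have e_snth: "e !! i \<longleftrightarrow> i \<ge> N \<and> y !! i" for i
      by (simp add: e_def)
    have e: "e \<in> tail_class N y"
      by (simp add: tail_class_def e_snth)
    define t where "t = swap_gen s"
    have t: "t \<noteq> s" "flips t N"
      using True by (auto simp: t_def flips_swap_gen) (metis flips_swap_gen)
    have "\<not> act t e !! N"
      using t(2) True by (simp add: act_snth e_snth zero_below_def)
    moreover have "act t e !! k = y !! k" if "k > N" for k
      using that True act_snth_after_one[of e N k t] by (simp add: e_snth)
    ultimately have "on_axis_from s (act t e) N"
      using Suc.prems unfolding on_axis_from_Suc[of s _ N] by (simp add: on_axis_from_def)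
    then have "(adj (fibre s (retract s (act t e))))\<^sup>*\<^sup>* (act t e) (retract s (act t e))"
      by (rule Suc.IH)
    moreover have ret: "retract s (act t e) = retract s y"
      using retract_act[of t s e] t(1) same[OF e] by simp
    moreover have "adj ?F e (act t e)"
      using sub e ret by (auto simp: adj_def fibre_def)
    moreover have "(adj ?F)\<^sup>*\<^sup>* y e"
      using tail_class_connected[OF e] adj_rtranclp_mono[OF sub] by blast
    ultimately show ?thesis
      by (metis rtranclp.rtrancl_into_rtrancl rtranclp_trans)
  qed
qed

text \<open>Filling the additional positions with 0s embeds the smaller fibre into the larger one. The image
  misses the word with a 1 directly before position \<open>q'\<close>, which is not a digit of \<open>s\<close>.\<close>

lemma card_fibre_less:
  assumes x: "zero_below q x" "x !! q" "x \<in> axis s"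
    and x': "zero_below q' x'" "x' !! q'" "x' \<in> axis s" and "q < q'"
  shows "card (fibre s x) < card (fibre s x')"
proof -
  \<comment> \<open>The letters of \<open>y\<close> before \<open>q\<close>, then the letters of \<open>x'\<close>, which are 0 up to \<open>q'\<close>.\<close>
  define h where "h = (\<lambda>y :: word. smap (\<lambda>k. if k < q then y !! k else x' !! k) nats)"
  have h_snth: "h y !! k = (if k < q then y !! k else x' !! k)" for y k
    by (simp add: h_def)
  have x'_axis: "x' !! k \<Longrightarrow> flips s k" for k
    using x'(3) by (simp add: axis_def)
  have h_fibre: "h y \<in> fibre s x'" if y: "y \<in> fibre s x" for y
  proof -
    have ret: "retract s y = x" using y by (simp add: fibre_def)
    then have y_axis: "on_axis_from s y q"
      using x(2) by (auto simp: retract_snth)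
    have "retract s (h y) !! k = x' !! k" for k
    proof (cases "k < q")
      case True
      have "on_axis_from s (h y) k \<Longrightarrow> on_axis_from s y k"
        using y_axis unfolding on_axis_from_def h_snth by (meson not_less)
      moreover have "\<not> retract s y !! k"
        using ret x(1) True by (simp add: zero_below_def)
      ultimately show ?thesis
        using True x'(1) \<open>q < q'\<close> by (auto simp: retract_snth h_snth zero_below_def)
    next
      case False
      then show ?thesis
        using x'_axis by (auto simp: retract_snth h_snth on_axis_from_def)
    qed
    then show ?thesis
      unfolding fibre_def by (blast intro: word_eqI)
  qed
  have "inj_on h (fibre s x)"
  proof (rule inj_onI)
    fix y z assume yz: "y \<in> fibre s x" "z \<in> fibre s x" "h y = h z"
    have "y !! k = z !! k" for k
    proof (cases "k < q")
      case True
      then show ?thesis using arg_cong[OF yz(3), of "\<lambda>w. w !! k"] by (simp add: h_snth)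
    next
      case False
      then show ?thesis
        using yz(1,2) fibre_tail_class[OF x(2)] by (auto simp: tail_class_def subset_iff)
    qed
    then show "y = z" by (rule word_eqI)
  qed
  then have "card (h ` fibre s x) = card (fibre s x)"
    by (rule card_image)
  define e where "e = smap (\<lambda>k. k = q' - 1 \<or> x' !! k) nats"
  have e_snth: "e !! k \<longleftrightarrow> k = q' - 1 \<or> x' !! k" for k
    by (simp add: e_def)
  have off: "\<not> flips s (q' - 1)"
    using x'_axis[OF x'(2)] \<open>q < q'\<close> flips_Suc[of s "q' - 1"] by simp
  have "retract s e !! k = x' !! k" for k
  proof (cases "k < q'")
    case True
    then have "k \<le> q' - 1" by simp
    then have "\<not> retract s e !! k"
      using off by (auto simp: retract_snth on_axis_from_def e_snth)
    then show ?thesis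
      using x'(1) True by (simp add: zero_below_def)
  next
    case False
    then show ?thesis
      using x'_axis \<open>q < q'\<close> by (auto simp: retract_snth on_axis_from_def e_snth)
  qed
  then have "e \<in> fibre s x'"
    unfolding fibre_def by (blast intro: word_eqI)
  moreover have "e \<notin> h ` fibre s x"
  proof
    assume "e \<in> h ` fibre s x"
    then obtain y where "e = h y" by blast
    then have "e !! (q' - 1) = x' !! (q' - 1)"
      using \<open>q < q'\<close> by (auto simp: h_snth)
    then show False
      using off x'_axis by (auto simp: e_snth)
  qed
  ultimately have "h ` fibre s x \<subset> fibre s x'"
    using h_fibre by blast
  then show ?thesis
    using psubset_card_mono[OF finite_fibre[OF x'(2)]] \<open>card (h ` fibre s x) = card (fibre s x)\<close> by metis
qed

lemma zero_below_eq_if_card_fibre_eq: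
  assumes "x \<in> axis s" "x' \<in> axis s" "x \<noteq> zeros" "x' \<noteq> zeros"
    and card: "card (fibre s x) = card (fibre s x')"
  shows "zero_below j x \<longleftrightarrow> zero_below j x'"
proof -
  have first: "\<exists>q. zero_below q z \<and> z !! q" if "z \<noteq> zeros" for z
    using that exists_least_iff[of "\<lambda>i. z !! i"] unfolding neq_zeros_iff zero_below_def by blast
  obtain q q' where q: "zero_below q x" "x !! q" "zero_below q' x'" "x' !! q'"
    using first assms(3,4) by blast
  then have "q = q'"
    using card_fibre_less[of q x s q' x'] card_fibre_less[of q' x' s q x] assms(1,2) card
    by (cases q q' rule: linorder_cases) auto
  moreover have "zero_below j z \<longleftrightarrow> j \<le> p" if "zero_below p z" "z !! p" for z p
    using that by (meson leI le_trans less_le_trans zero_below_def)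
  ultimately show ?thesis
    using q by blast
qed

section \<open>Recognising the axis and the fibres in the graph\<close>

definition component :: "word set \<Rightarrow> word \<Rightarrow> word set" where
  "component S x = {y. (adj S)\<^sup>*\<^sup>* x y}"

text \<open>This notion is invariant under isomorphisms and singles out the axis (lemma \<open>axis_iff_separating\<close>).\<close>

definition separating :: "word \<Rightarrow> word \<Rightarrow> bool" where
  "separating \<xi> x \<longleftrightarrow> (\<exists>y\<in>basilica_orbit \<xi> - {x}. \<exists>z\<in>basilica_orbit \<xi> - {x}.
     infinite (component (basilica_orbit \<xi> - {x}) y) \<and> infinite (component (basilica_orbit \<xi> - {x}) z) \<and>
     z \<notin> component (basilica_orbit \<xi> - {x}) y)"

lemma component_closed:
  assumes "w \<in> component S y" "y \<in> A" "\<And>p q. adj S p q \<Longrightarrow> p \<in> A \<Longrightarrow> q \<in> A"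
  shows "w \<in> A"
  using assms(1) unfolding component_def mem_Collect_eq
  by (induction rule: rtranclp_induct) (use assms(2,3) in auto)

lemma step_retract:
  assumes "step p q" "\<not> (p \<in> axis s \<and> q \<in> axis s)"
  shows "retract s p = retract s q"
  using assms retract_act act_axis_iff unfolding step_def by metis

text \<open>Deleting the other points of the axis cuts off the piece that hangs at \<open>x\<close>. The size of this piece is
  therefore an invariant of the graph together with its axis.\<close>

lemma component_eq_fibre:
  assumes x: "x \<in> axis s" "x \<in> basilica_orbit \<xi>" "x \<noteq> zeros"
  shows "component (basilica_orbit \<xi> - (axis s - {x})) x = fibre s x"
proof
  let ?S = "basilica_orbit \<xi> - (axis s - {x})"
  have closed: "q \<in> fibre s x" if "adj ?S p q" "p \<in> fibre s x" for p q
  proof (cases "p \<in> axis s \<and> q \<in> axis s")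
    case True
    then show ?thesis using that fibre_self by (auto simp: adj_def)
  next
    case False
    then show ?thesis
      using that step_retract[of p q s] by (auto simp: adj_def fibre_def)
  qed
  show "component ?S x \<subseteq> fibre s x"
    using component_closed[of _ ?S x "fibre s x"] closed fibre_self[OF x(1)] by blast
  obtain q where q: "x !! q"
    using x(3) by (auto simp: neq_zeros_iff)
  show "fibre s x \<subseteq> component ?S x"
  proof
    fix y assume y: "y \<in> fibre s x"
    then have ret: "retract s y = x" by (simp add: fibre_def)
    have "fibre s x \<subseteq> ?S"
      using fibre_tail_class[OF q, of s] orbit_tail_class[OF x(2), of q]
      by (auto simp: fibre_def retract_axis)
    moreover have "on_axis_from s y q"
      using q ret by (auto simp: retract_snth)
    ultimately have "(adj ?S)\<^sup>*\<^sup>* y x"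
      using fibre_connected[of s y q] adj_rtranclp_mono unfolding ret by blast
    then show "y \<in> component ?S x"
      by (simp add: component_def adj_rtranclp_sym)
  qed
qed

text \<open>The points of the axis before and after \<open>x\<close> are separated, because a path that avoids \<open>x\<close> retracts
  to a path on the axis that avoids \<open>x\<close>.\<close>

lemma axis_separating:
  assumes x: "x \<in> axis s" "x \<in> basilica_orbit \<xi>" "infinite {i. x !! i}"
  shows "separating \<xi> x"
proof -
  let ?S = "basilica_orbit \<xi> - {x}"
  note neq = act_pow_axis_neq[OF x(1,3)]
  have orb: "(act s ^^ n) x \<in> basilica_orbit \<xi>" "(act_inv s ^^ n) x \<in> basilica_orbit \<xi>" for n
    using x(2) orbit_step step_act(1) step_act_inv(1) by (induction n; force)+
  have neq': "(act_inv s ^^ n) x \<noteq> x" if "n > 0" for n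
    using neq[OF that] act_pow_act_inv_pow[of n s x] by auto
  have fwd: "(act s ^^ Suc n) x \<in> component ?S (act s x)" for n
  proof (induction n)
    case (Suc n)
    have "adj ?S ((act s ^^ Suc n) x) ((act s ^^ Suc (Suc n)) x)"
      using orb(1)[of "Suc n"] orb(1)[of "Suc (Suc n)"] neq[of "Suc n"] neq[of "Suc (Suc n)"] by (simp add: adj_def)
    with Suc show ?case
      unfolding component_def mem_Collect_eq by (rule rtranclp.rtrancl_into_rtrancl)
  qed (simp add: component_def)
  have bwd: "(act_inv s ^^ Suc n) x \<in> component ?S (act_inv s x)" for n
  proof (induction n)
    case (Suc n)
    have "adj ?S ((act_inv s ^^ Suc n) x) ((act_inv s ^^ Suc (Suc n)) x)"
      using orb(2)[of "Suc n"] orb(2)[of "Suc (Suc n)"] neq'[of "Suc n"] neq'[of "Suc (Suc n)"] by (simp add: adj_def)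
    with Suc show ?case
      unfolding component_def mem_Collect_eq by (rule rtranclp.rtrancl_into_rtrancl)
  qed (simp add: component_def)
  have inf: "infinite (range (\<lambda>n. (act s ^^ Suc n) x))" "infinite (range (\<lambda>n. (act_inv s ^^ Suc n) x))"
    using inj_act_pow[OF neq, THEN inj_compose, OF _ inj_Suc]
    by (simp_all only: o_def range_inj_infinite not_False_eq_True)
  \<comment> \<open>The words that retract to a point of the axis strictly after \<open>x\<close>.\<close>
  define A where "A = {v. \<exists>n. retract s v = (act s ^^ Suc n) x}"
  have closed: "q \<in> A" if pq: "adj ?S p q" "p \<in> A" for p q
  proof (cases "p \<in> axis s \<and> q \<in> axis s")
    case False
    then show ?thesis
      using pq step_retract[of p q s] by (auto simp: adj_def A_def)
  next
    case True
    then obtain n where n: "p = (act s ^^ Suc n) x"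
      using pq by (auto simp: A_def retract_axis)
    from pq True have "p = q \<or> q = act s p \<or> p = act s q"
      using axis_neighbour by (auto simp: adj_def)
    then show ?thesis
    proof (elim disjE)
      assume "q = act s p"
      then have "q = (act s ^^ Suc (Suc n)) x" by (simp add: n)
      then show ?thesis
        using True unfolding A_def by (auto simp: retract_axis simp del: funpow.simps)
    next
      assume "p = act s q"
      then have q: "q = (act s ^^ n) x"
        by (simp add: n act_eq_iff)
      then obtain m where "n = Suc m"
        using pq by (cases n) (auto simp: adj_def)
      then show ?thesis
        using True q unfolding A_def by (auto simp: retract_axis simp del: funpow.simps)
    qed (use pq in simp)
  qed
  have "act s x \<in> A"
    using x(1) by (auto simp: A_def retract_axis act_axis_iff intro!: exI[of _ 0])
  moreover have "act_inv s x \<notin> A"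
  proof
    assume "act_inv s x \<in> A"
    then obtain n where "act_inv s x = (act s ^^ Suc n) x"
      using x(1) by (auto simp: A_def retract_axis act_inv_axis)
    then have "(act s ^^ Suc (Suc n)) x = x"
      by (metis act_inv_right funpow.simps(2) o_apply)
    then show False using neq by blast
  qed
  ultimately have "act_inv s x \<notin> component ?S (act s x)"
    using component_closed closed by blast
  moreover have "infinite (component ?S (act s x))" "infinite (component ?S (act_inv s x))"
    using fwd bwd inf infinite_super image_subsetI by (metis (no_types, lifting))+
  moreover have "act s x \<in> ?S" "act_inv s x \<in> ?S"
    using orb[of 1] neq[of 1] neq'[of 1] by auto
  ultimately show ?thesis
    unfolding separating_def by blast
qed

text \<open>The fibres of the retraction are finite, so an infinite component must meet the axis, and the axis
  stays connected if \<open>x\<close> is not on it.\<close>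

lemma off_axis_not_separating:
  assumes \<xi>: "zeros \<notin> basilica_orbit \<xi>" "two_ended_word s \<xi>" and x: "x \<notin> axis s"
  shows "\<not> separating \<xi> x"
proof
  let ?S = "basilica_orbit \<xi> - {x}"
  assume "separating \<xi> x"
  then obtain y z where y: "y \<in> ?S" "infinite (component ?S y)"
    and z: "z \<in> ?S" "infinite (component ?S z)" and sep: "z \<notin> component ?S y"
    unfolding separating_def by blast
  have meets: "\<exists>u\<in>component ?S y. u \<in> axis s" if y: "y \<in> ?S" "infinite (component ?S y)" for y
  proof (rule ccontr)
    assume none: "\<not> (\<exists>u\<in>component ?S y. u \<in> axis s)"
    have "w \<in> fibre s (retract s y) \<inter> component ?S y" if "w \<in> component ?S y" for w
      using that
    proof (rule component_closed)
      show "y \<in> fibre s (retract s y) \<inter> component ?S y"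
        by (simp add: fibre_def component_def)
      fix p q assume pq: "adj ?S p q" "p \<in> fibre s (retract s y) \<inter> component ?S y"
      then have "q \<in> component ?S y"
        by (auto simp: component_def)
      then show "q \<in> fibre s (retract s y) \<inter> component ?S y"
        using pq none step_retract[of p q s] by (auto simp: fibre_def adj_def)
    qed
    then have sub: "component ?S y \<subseteq> fibre s (retract s y)" by blast
    have two: "two_ended_word s y"
      using two_ended_word_orbit[OF \<xi>] y(1) by blast
    then obtain N where N: "on_axis_from s y N"
      by (rule two_ended_word_on_axis_from)
    obtain i where "i > N" "y !! i"
      using two_ended_word_later_one[OF two] by blast
    then have "retract s y !! i"
      using N by (simp add: retract_snth_tail)
    then show False
      using y(2) finite_fibre finite_subset[OF sub] by blast
  qed
  obtain u where u: "u \<in> component ?S y" "u \<in> axis s" using meets[OF y] by blast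
  obtain v where v: "v \<in> component ?S z" "v \<in> axis s" using meets[OF z] by blast
  have uv: "u \<in> ?S" "v \<in> ?S"
    using u(1) v(1) y(1) z(1) adj_rtranclp_in by (auto simp: component_def)
  have "cofinal_words u v"
    using uv cofinal_trans[OF cofinal_sym] orbit_eq_cofinal_class[OF \<xi>(1)] by blast
  then obtain m n where meet: "(act s ^^ m) u = (act s ^^ n) v"
    using axis_cofinal_meet u(2) v(2) by blast
  have along: "(adj ?S)\<^sup>*\<^sup>* w ((act s ^^ n) w)" if w: "w \<in> axis s" "w \<in> ?S" for w n
  proof -
    have in_S: "(act s ^^ n) w \<in> ?S" for n
    proof -
      have "(act s ^^ n) w \<in> basilica_orbit \<xi>"
        using w(2) orbit_step step_act(1) by (induction n) auto
      then show ?thesis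
        using x act_pow_axis[OF w(1), of n] by blast
    qed
    show ?thesis
    proof (induction n)
      case (Suc n)
      have "adj ?S ((act s ^^ n) w) ((act s ^^ Suc n) w)"
        using in_S[of n] in_S[of "Suc n"] by (simp add: adj_def)
      with Suc show ?case by (rule rtranclp.rtrancl_into_rtrancl)
    qed simp
  qed
  have "(adj ?S)\<^sup>*\<^sup>* u v"
    using along[OF u(2) uv(1), of m] along[OF v(2) uv(2), of n] adj_rtranclp_sym unfolding meet
    by (meson rtranclp_trans)
  then have "(adj ?S)\<^sup>*\<^sup>* y z"
    using u(1) v(1) adj_rtranclp_sym unfolding component_def mem_Collect_eq
    by (meson rtranclp_trans)
  then show False
    using sep by (simp add: component_def)
qed

lemma schreier_map_component:
  assumes f: "schreier_map \<xi> \<eta> f" and S: "S \<subseteq> basilica_orbit \<xi>" and x: "x \<in> S"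
  shows "f ` component S x = component (f ` S) (f x)"
proof
  show "f ` component S x \<subseteq> component (f ` S) (f x)"
    using schreier_map_path[OF f _ S] by (auto simp: component_def)
  obtain g where g: "schreier_map \<eta> \<xi> g" "\<And>x. x \<in> basilica_orbit \<xi> \<Longrightarrow> g (f x) = x"
    "\<And>y. y \<in> basilica_orbit \<eta> \<Longrightarrow> f (g y) = y"
    using schreier_map_obtain_inverse[OF f] by metis
  have fS: "f ` S \<subseteq> basilica_orbit \<eta>"
    using S schreier_map_in[OF f] by auto
  have gfS: "g ` f ` S = S"
    using g(2) S by (force simp: image_image)
  show "component (f ` S) (f x) \<subseteq> f ` component S x"
  proof
    fix w assume w: "w \<in> component (f ` S) (f x)"
    then have "w \<in> f ` S"
      using x adj_rtranclp_in unfolding component_def by blast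
    moreover have "g w \<in> component S x"
      using schreier_map_path[OF g(1) _ fS, of "f x" w] w g(2) x S unfolding gfS component_def by auto
    ultimately show "w \<in> f ` component S x"
      using g(3) fS by (metis imageI subsetD)
  qed
qed

lemma schreier_map_inj_on:
  assumes "schreier_map \<xi> \<eta> f" "S \<subseteq> basilica_orbit \<xi>"
  shows "inj_on f S"
  using assms by (auto simp: schreier_map_def bij_betw_def intro: inj_on_subset)

lemma component_subset: "x \<in> S \<Longrightarrow> component S x \<subseteq> S"
  using adj_rtranclp_in by (auto simp: component_def)

lemma schreier_map_separating_imp:
  assumes f: "schreier_map \<xi> \<eta> f" and x: "x \<in> basilica_orbit \<xi>" and sep: "separating \<xi> x"
  shows "separating \<eta> (f x)"
proof -
  let ?S = "basilica_orbit \<xi> - {x}"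
  have fS: "f ` ?S = basilica_orbit \<eta> - {f x}"
    using f x by (auto simp: schreier_map_def bij_betw_def inj_on_def)
  obtain y z where yz: "y \<in> ?S" "z \<in> ?S" "infinite (component ?S y)" "infinite (component ?S z)"
    "z \<notin> component ?S y"
    using sep unfolding separating_def by blast
  have inj: "inj_on f ?S"
    by (rule schreier_map_inj_on[OF f]) blast
  have comp: "f ` component ?S w = component (f ` ?S) (f w)" if "w \<in> ?S" for w
    by (rule schreier_map_component[OF f _ that]) blast
  have "infinite (component (f ` ?S) (f w))" if "w \<in> ?S" "infinite (component ?S w)" for w
    using that comp[OF that(1)] inj_on_subset[OF inj component_subset[OF that(1)]] finite_imageD by metis
  moreover have "f z \<notin> component (f ` ?S) (f y)"
    using comp[OF yz(1)] inj component_subset[OF yz(1)] yz(2,5) by (metis inj_on_image_mem_iff)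
  ultimately show ?thesis
    using yz unfolding separating_def fS[symmetric] by blast
qed

lemma schreier_map_separating:
  assumes f: "schreier_map \<xi> \<eta> f" and x: "x \<in> basilica_orbit \<xi>"
  shows "separating \<eta> (f x) \<longleftrightarrow> separating \<xi> x"
proof -
  obtain g where g: "schreier_map \<eta> \<xi> g" "\<And>x. x \<in> basilica_orbit \<xi> \<Longrightarrow> g (f x) = x"
    using schreier_map_obtain_inverse[OF f] by metis
  show ?thesis
    using schreier_map_separating_imp[OF f x] schreier_map_separating_imp[OF g(1) schreier_map_in[OF f x]] g(2)[OF x]
    by auto
qed

section \<open>Rigidity of isomorphisms\<close>

lemma axis_iff_separating:
  assumes "zeros \<notin> basilica_orbit \<xi>" "two_ended_word s \<xi>" "x \<in> basilica_orbit \<xi>"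
  shows "x \<in> axis s \<longleftrightarrow> separating \<xi> x"
proof -
  have "two_ended_word s x"
    by (rule two_ended_word_orbit[OF assms])
  then have "infinite {i. x !! i}"
    unfolding two_ended_word_def using rev_finite_subset[of "{i. x !! i}"] by auto
  then show ?thesis
    using axis_separating[of x s \<xi>] off_axis_not_separating[OF assms(1,2), of x] assms(3) by blast
qed

text \<open>The fixed points of \<open>a\<close> are the words that start with 1, and \<open>b\<close> has none; position 0 is a digit of
  \<open>b\<close> but not of \<open>a\<close>. So half of the axis of \<open>b\<close> carries loops, and the axis of \<open>a\<close> carries none.\<close>

lemma axis_has_loop_iff:
  assumes "x \<in> axis s" "x \<in> basilica_orbit \<xi>"
  shows "(\<exists>y\<in>axis s \<inter> basilica_orbit \<xi>. step y y) \<longleftrightarrow> s = Gen_b"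
proof
  assume "\<exists>y\<in>axis s \<inter> basilica_orbit \<xi>. step y y"
  then obtain y t where y: "y \<in> axis s" and t: "act t y = y"
    by (auto simp: step_def eq_commute)
  show "s = Gen_b"
  proof (rule ccontr)
    assume "s \<noteq> Gen_b"
    then have "s = Gen_a" by (cases s) auto
    then have "\<not> y !! 0"
      using y by (auto simp: axis_def flips_def simp del: snth.simps)
    then have "act t y !! 0 \<noteq> y !! 0 \<or> act t y !! 1 \<noteq> y !! 1"
      by (cases t) (auto simp: act_snth zero_below_def flips_def simp del: snth.simps)
    then show False by (simp add: t)
  qed
next
  assume s: "s = Gen_b"
  obtain y where y: "y \<in> axis s" "y \<in> basilica_orbit \<xi>" "y !! 0"
  proof (cases "x !! 0")
    case False
    then have "act s x !! 0"
      using s by (simp add: act_snth flips_def del: snth.simps)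
    then show ?thesis
      using that[of "act s x"] assms orbit_step[OF assms(2) step_act(1)] by (simp add: act_axis_iff)
  qed (use assms that in blast)
  then have "act Gen_a y = y"
    using axis_act_other[of y s Gen_a] s
    by (intro word_eqI) (auto simp: act_snth zero_below_def flips_def simp del: snth.simps intro: gr0I)
  then have "step y y"
    using step_act(1)[of y Gen_a] by simp
  then show "\<exists>y\<in>axis s \<inter> basilica_orbit \<xi>. step y y"
    using y by blast
qed

text \<open>The image \<open>y n\<close> of the trajectory \<open>x n\<close> on the axis is an injective walk on the other axis, hence it
  runs in one direction forever. By comparison of first 1s, \<open>x 0\<close> equals \<open>y 0\<close> or, if the direction is
  reversed, \<open>mirror s (y 0)\<close>.\<close>

lemma schreier_map_rigid:
  assumes \<xi>: "zeros \<notin> basilica_orbit \<xi>" "two_ended_word s \<xi>"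
    and \<eta>: "zeros \<notin> basilica_orbit \<eta>" "two_ended_word t \<eta>"
    and f: "schreier_map \<xi> \<eta> f"
  shows "\<eta> \<in> basilica_orbit \<xi> \<or> \<eta> \<in> basilica_orbit (mirror s \<xi>)"
proof -
  note f_in = schreier_map_in[OF f] and f_inj = schreier_map_inj[OF f] and f_step = schreier_map_step[OF f]
  have f_axis: "f x \<in> axis t \<longleftrightarrow> x \<in> axis s" if "x \<in> basilica_orbit \<xi>" for x
    using axis_iff_separating[OF \<xi> that] axis_iff_separating[OF \<eta> f_in[OF that]]
      schreier_map_separating[OF f that] by simp
  define x where "x = (\<lambda>n. (act s ^^ n) (retract s \<xi>))"
  obtain N where N: "on_axis_from s \<xi> N"
    using two_ended_word_on_axis_from[OF \<xi>(2)] .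
  have x0: "x 0 \<in> basilica_orbit \<xi>"
    using retract_tail_class[OF N] orbit_tail_class[OF orbit_self] by (auto simp: x_def)
  have x_orbit: "x n \<in> basilica_orbit \<xi>" for n
    using x0 orbit_step step_act(1) by (induction n) (auto simp: x_def)
  have x_axis: "x n \<in> axis s" for n
    by (simp add: x_def act_pow_axis)
  define y where "y = (\<lambda>n. f (x n))"
  have y_orbit: "y n \<in> basilica_orbit \<eta>" and y_axis_t: "y n \<in> axis t" for n
    using f_in f_axis x_orbit x_axis by (auto simp: y_def)
  have "(\<exists>v\<in>axis s \<inter> basilica_orbit \<xi>. step v v) \<longleftrightarrow> (\<exists>v\<in>axis t \<inter> basilica_orbit \<eta>. step v v)"
  proof -
    have "basilica_orbit \<eta> = f ` basilica_orbit \<xi>"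
      using f by (simp add: schreier_map_def bij_betw_def)
    then have "axis t \<inter> basilica_orbit \<eta> = f ` (axis s \<inter> basilica_orbit \<xi>)"
      using f_axis by auto
    then show ?thesis
      by (auto simp: f_step)
  qed
  then have "s = Gen_b \<longleftrightarrow> t = Gen_b"
    using axis_has_loop_iff x_axis x_orbit y_axis_t y_orbit by blast
  then have "t = s"
    by (cases s; cases t) auto
  then have y_axis: "y n \<in> axis s" for n
    using y_axis_t by simp
  have nonzero: "v \<noteq> zeros" if "v \<in> basilica_orbit \<xi> \<or> v \<in> basilica_orbit \<eta>" for v
    using that \<xi>(1) \<eta>(1) by blast
  \<comment> \<open>The isomorphism maps the piece at \<open>x n\<close> onto the piece at \<open>y n\<close>, and its size determines the first 1.\<close>
  have first: "zero_below j (x n) \<longleftrightarrow> zero_below j (y n)" for j n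
  proof (rule zero_below_eq_if_card_fibre_eq[OF x_axis y_axis])
    let ?S = "basilica_orbit \<xi> - (axis s - {x n})"
    have xS: "x n \<in> ?S"
      using x_orbit by simp
    have "f ` ?S = basilica_orbit \<eta> - (axis s - {y n})"
    proof
      show "f ` ?S \<subseteq> basilica_orbit \<eta> - (axis s - {y n})"
        using f_in f_axis \<open>t = s\<close> by (auto simp: y_def)
      show "basilica_orbit \<eta> - (axis s - {y n}) \<subseteq> f ` ?S"
      proof
        fix w assume w: "w \<in> basilica_orbit \<eta> - (axis s - {y n})"
        then obtain v where v: "v \<in> basilica_orbit \<xi>" "w = f v"
          using f unfolding schreier_map_def bij_betw_def by blast
        then have "v \<in> ?S"
          using w f_axis[OF v(1)] \<open>t = s\<close> f_inj[OF v(1) x_orbit[of n]] by (auto simp: y_def)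
        then show "w \<in> f ` ?S"
          using v by blast
      qed
    qed
    then have "f ` fibre s (x n) = fibre s (y n)"
      using schreier_map_component[OF f _ xS] component_eq_fibre[OF x_axis x_orbit]
        component_eq_fibre[OF y_axis y_orbit] nonzero x_orbit y_orbit unfolding y_def
      by (metis (lifting) Diff_subset)
    moreover have "fibre s (x n) \<subseteq> basilica_orbit \<xi>"
      using component_eq_fibre[OF x_axis x_orbit, of n] component_subset[OF xS] nonzero x_orbit by blast
    ultimately show "card (fibre s (x n)) = card (fibre s (y n))"
      using card_image[OF schreier_map_inj_on[OF f]] by metis
  qed (use nonzero x_orbit y_orbit in auto)
  have "infinite {i. x 0 !! i}"
    using two_ended_word_orbit[OF \<xi> x0] rev_finite_subset[of "{i. x 0 !! i}"]
    unfolding two_ended_word_def by auto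
  then have "inj x"
    using inj_act_pow(1)[OF act_pow_axis_neq[OF x_axis[of 0]]] by (simp add: x_def)
  then have y_eq: "y m = y n \<longleftrightarrow> m = n" for m n
    using f_inj[OF x_orbit x_orbit] by (simp add: y_def inj_eq)
  have next_y: "y (Suc n) = act s (y n) \<or> y n = act s (y (Suc n))" for n
  proof (rule axis_neighbour[OF y_axis y_axis])
    have "step (x n) (x (Suc n))" by (simp add: x_def)
    then show "step (y n) (y (Suc n))"
      using f_step[OF x_orbit x_orbit] by (simp add: y_def)
  qed (simp add: y_eq)
  \<comment> \<open>A turn would make the injective sequence \<open>y\<close> return to \<open>y n\<close>.\<close>
  have no_turn: "y (Suc n) = act s (y n) \<longleftrightarrow> y (Suc (Suc n)) = act s (y (Suc n))" for n
  proof -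
    have "y n \<noteq> y (Suc (Suc n))"
      by (simp add: y_eq)
    then show ?thesis
      using next_y[of n] next_y[of "Suc n"] act_eq_iff[of s "y n" "y (Suc (Suc n))"] by metis
  qed
  consider "\<And>n. y (Suc n) = act s (y n)" | "\<And>n. y n = act s (y (Suc n))"
  proof (cases "y (Suc 0) = act s (y 0)")
    case True
    then have "y (Suc n) = act s (y n)" for n
      by (induction n) (use no_turn in blast)+
    then show ?thesis using that by blast
  next
    case False
    then have "y (Suc n) \<noteq> act s (y n)" for n
      by (induction n) (use no_turn in blast)+
    then show ?thesis using that next_y by blast
  qed
  moreover have x_pow: "x n = (act s ^^ n) (x 0)" for n
    by (simp add: x_def)
  ultimately show ?thesis
  proof cases
    case 1
    then have y_pow: "y n = (act s ^^ n) (y 0)" for n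
      by (induction n) auto
    have "x 0 = y 0"
    proof (rule axis_eq_from_first_ones[OF x_axis y_axis])
      show "zero_below j ((act s ^^ n) (x 0)) \<longleftrightarrow> zero_below j ((act s ^^ n) (y 0))" for n j
        unfolding x_pow[symmetric] y_pow[symmetric] by (rule first)
    qed
    then show ?thesis
      using x0 y_orbit[of 0] orbit_eq orbit_self by metis
  next
    case 2
    have "mirror s (y (Suc n)) = act s (mirror s (y n))" for n
      using mirror_act_axis[OF y_axis[of "Suc n"]] 2[of n] by simp
    then have y_pow: "mirror s (y n) = (act s ^^ n) (mirror s (y 0))" for n
      by (induction n) auto
    have "x 0 = mirror s (y 0)"
    proof (rule axis_eq_from_first_ones[OF x_axis])
      show "mirror s (y 0) \<in> axis s"
        using y_axis by simp
      show "zero_below j ((act s ^^ n) (x 0)) \<longleftrightarrow> zero_below j ((act s ^^ n) (mirror s (y 0)))" for n j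
        unfolding x_pow[symmetric] y_pow[symmetric] zero_below_mirror by (rule first)
    qed
    then have "y 0 \<in> basilica_orbit (mirror s \<xi>)"
      using mirror_orbit[OF x0, of s] by simp
    then show ?thesis
      using y_orbit[of 0] orbit_eq orbit_self by metis
  qed
qed

section \<open>The bar operation\<close>

lemma mirror_eventually:
  assumes "two_ended_word s \<xi>"
  obtains M where "\<And>k. k \<ge> M \<Longrightarrow> mirror s \<xi> !! k \<longleftrightarrow> flips s k \<and> \<not> \<xi> !! k"
proof -
  obtain N where N: "on_axis_from s \<xi> N"
    using two_ended_word_on_axis_from[OF assms] .
  obtain p where p: "p > N" "\<xi> !! p"
    using two_ended_word_later_one[OF assms] by blast
  have "mirror s \<xi> !! k \<longleftrightarrow> flips s k \<and> \<not> \<xi> !! k" if "k \<ge> Suc p" for k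
  proof -
    have "retract s \<xi> !! p"
      using p retract_snth_tail[OF N] by simp
    then have "\<not> zero_below k (retract s \<xi>)"
      using that by (auto simp: zero_below_def Suc_le_eq)
    moreover have "\<xi> !! k \<Longrightarrow> flips s k"
      using N p that by (simp add: on_axis_from_def)
    ultimately show ?thesis
      by (auto simp: mirror_snth)
  qed
  then show ?thesis by (rule that)
qed

text \<open>The prefix of length \<open>n\<close> ends with \<open>10\<^sup>k1\<close> for an even \<open>k\<close>: two consecutive 1s at positions of different
  parity.\<close>

definition switch_end :: "word \<Rightarrow> nat \<Rightarrow> bool" where
  "switch_end \<xi> n \<longleftrightarrow> (\<exists>p q. n = Suc q \<and> p < q \<and> odd (q - p) \<and> \<xi> !! p \<and> \<xi> !! q \<and>
     (\<forall>i. p < i \<and> i < q \<longrightarrow> \<not> \<xi> !! i))"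

lemma switch_end_iff:
  "(\<exists>u k. even k \<and> stake n \<xi> = u @ [True] @ replicate k False @ [True]) \<longleftrightarrow> switch_end \<xi> n"
proof
  assume "\<exists>u k. even k \<and> stake n \<xi> = u @ [True] @ replicate k False @ [True]"
  then obtain u k where k: "even k" and eq: "stake n \<xi> = u @ [True] @ replicate k False @ [True]"
    by blast
  let ?p = "length u" and ?q = "length u + k + 1"
  have n: "n = Suc ?q"
    using arg_cong[OF eq, of length] by simp
  have letters: "\<xi> !! i = (u @ [True] @ replicate k False @ [True]) ! i" if "i < n" for i
    using stake_nth[OF that, of \<xi>] by (simp add: eq)
  have "\<xi> !! ?p" "\<xi> !! ?q"
    using letters[of ?p] letters[of ?q] n by (simp_all add: nth_append)
  moreover have "\<not> \<xi> !! i" if "?p < i" "i < ?q" for i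
    using letters[of i] that n by (auto simp: nth_append nth_Cons split: nat.splits)
  ultimately show "switch_end \<xi> n"
    unfolding switch_end_def using n k by (intro exI[of _ ?p] exI[of _ ?q]) auto
next
  assume "switch_end \<xi> n"
  then obtain p q where pq: "n = Suc q" "p < q" "odd (q - p)" "\<xi> !! p" "\<xi> !! q"
    "\<And>i. p < i \<Longrightarrow> i < q \<Longrightarrow> \<not> \<xi> !! i"
    unfolding switch_end_def by blast
  have "stake n \<xi> = stake p \<xi> @ [True] @ replicate (q - p - 1) False @ [True]"
  proof (rule nth_equalityI)
    show "length (stake n \<xi>) = length (stake p \<xi> @ [True] @ replicate (q - p - 1) False @ [True])"
      using pq(1,2) by simp
    fix i assume "i < length (stake n \<xi>)"
    then have i: "stake n \<xi> ! i = \<xi> !! i"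
      by (simp only: length_stake stake_nth)
    have "i < p \<or> i = p \<or> p < i \<and> i < q \<or> i = q"
      using \<open>i < length (stake n \<xi>)\<close> pq(1) by auto
    then show "stake n \<xi> ! i = (stake p \<xi> @ [True] @ replicate (q - p - 1) False @ [True]) ! i"
    proof (elim disjE)
      assume "i < p"
      then show ?thesis unfolding i by (simp add: nth_append)
    next
      assume "i = p"
      then show ?thesis using pq(4) unfolding i by (simp add: nth_append)
    next
      assume "p < i \<and> i < q"
      then show ?thesis using pq(6)[of i] unfolding i by (auto simp: nth_append nth_Cons')
    next
      assume "i = q"
      then show ?thesis using pq(2,5) unfolding i by (simp add: nth_append nth_Cons')
    qed
  qed
  moreover have "even (q - p - 1)"
    using pq(2,3) by simp
  ultimately show "\<exists>u k. even k \<and> stake n \<xi> = u @ [True] @ replicate k False @ [True]"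
    by blast
qed

lemma odd_diff_iff_flips: "p < q \<Longrightarrow> odd (q - p) \<longleftrightarrow> flips s p \<noteq> flips s q"
  by (auto simp: flips_def)

text \<open>Behind every 1 that is not a digit of \<open>s\<close> the 1s switch to the parity of \<open>s\<close> again, as infinitely many
  digits are 1.\<close>

lemma switch_end_after_off_one:
  assumes "two_ended_word s \<xi>" and o: "\<xi> !! m" "\<not> flips s m"
  shows "\<exists>q>m. switch_end \<xi> (Suc q)"
proof -
  obtain i where "i > m" "\<xi> !! i" "flips s i"
    using two_ended_word_later_one[OF assms(1)] by blast
  then obtain q where q: "q > m" "\<xi> !! q" "flips s q"
    and least: "\<And>j. j < q \<Longrightarrow> \<not> (j > m \<and> \<xi> !! j \<and> flips s j)"
    using exists_least_iff[of "\<lambda>i. i > m \<and> \<xi> !! i \<and> flips s i"] by blast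
  define p where "p = Max {j. j < q \<and> \<xi> !! j}"
  have fin: "finite {j. j < q \<and> \<xi> !! j}" by simp
  have m: "m \<in> {j. j < q \<and> \<xi> !! j}"
    using q(1) o(1) by simp
  have p: "p < q" "\<xi> !! p" "m \<le> p"
    using Max_in[OF fin] Max_ge[OF fin m] m unfolding p_def by blast+
  have between: "\<not> \<xi> !! i" if "p < i" "i < q" for i
  proof
    assume "\<xi> !! i"
    then have "i \<le> p"
      unfolding p_def using fin that(2) by (intro Max_ge) auto
    then show False using that(1) by simp
  qed
  have "\<not> flips s p"
    using p least[of p] o(2) by (cases "p = m") auto
  then have "odd (q - p)"
    using odd_diff_iff_flips[OF p(1), of s] q(3) by simp
  then have "switch_end \<xi> (Suc q)"
    unfolding switch_end_def using p q between by blast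
  then show ?thesis
    using q(1) by blast
qed

lemma switch_end_bounded:
  assumes "two_ended_word s \<xi>"
  obtains b where "\<And>n. switch_end \<xi> n \<Longrightarrow> n \<le> b"
proof -
  obtain N where N: "on_axis_from s \<xi> N"
    using two_ended_word_on_axis_from[OF assms] .
  obtain M where M: "M > N" "\<xi> !! M"
    using two_ended_word_later_one[OF assms] by blast
  have "n \<le> Suc M" if switch: "switch_end \<xi> n" for n
  proof (rule ccontr)
    assume "\<not> n \<le> Suc M"
    moreover obtain p q where pq: "n = Suc q" "p < q" "odd (q - p)" "\<xi> !! p" "\<xi> !! q"
      "\<And>i. p < i \<Longrightarrow> i < q \<Longrightarrow> \<not> \<xi> !! i"
      using switch unfolding switch_end_def by blast
    ultimately have "M < q" by simp
    then have "M \<le> p"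
      using pq(6)[of M] M(2) by (meson not_le)
    then have "flips s p" "flips s q"
      using N M pq(4,5) \<open>M < q\<close> by (auto simp: on_axis_from_def)
    then show False
      using odd_diff_iff_flips[OF pq(2), of s] pq(3) by simp
  qed
  then show ?thesis by (rule that)
qed

text \<open>The last switch of parity leads to a digit of \<open>s\<close>, so the prefix ends there and the position after it is
  not a digit. Up to cofinality, \<open>bar\<close> depends on this parity alone.\<close>

lemma bar_prefix_length_parity:
  assumes "two_ended_word s \<xi>"
  shows "\<not> flips s (bar_prefix_length \<xi>)"
proof -
  obtain i where i: "\<xi> !! i" "flips s i"
    using two_ended_word_later_one[OF assms] by blast
  consider (even_zero) "\<forall>i. \<not> \<xi> !! (2 * i)"
    | (odd_zero) "\<not> (\<forall>i. \<not> \<xi> !! (2 * i))" "\<forall>i. \<not> \<xi> !! (2 * i + 1)"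
    | (mixed) "\<not> (\<forall>i. \<not> \<xi> !! (2 * i))" "\<not> (\<forall>i. \<not> \<xi> !! (2 * i + 1))"
    by blast
  then show ?thesis
  proof cases
    case even_zero
    then have "odd i"
      using i(1) by (auto elim: evenE)
    then show ?thesis
      using i(2) even_zero by (simp add: bar_prefix_length_def flips_def)
  next
    case odd_zero
    have "even i"
    proof (rule ccontr)
      assume "odd i"
      then obtain j where "i = 2 * j + 1" by (rule oddE)
      then show False using i(1) odd_zero(2) by blast
    qed
    then show ?thesis
      using i(2) odd_zero by (simp add: bar_prefix_length_def flips_def)
  next
    case mixed
    have n: "bar_prefix_length \<xi> = (GREATEST n. switch_end \<xi> n)"
      unfolding bar_prefix_length_def switch_end_iff by (simp only: mixed if_False)
    from mixed obtain j l where "\<xi> !! (2 * j)" "\<xi> !! (2 * l + 1)"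
      by blast
    then have "\<exists>m. \<xi> !! m \<and> \<not> flips s m"
      unfolding flips_def by (metis dvd_triv_left even_plus_one_iff)
    then obtain n0 where n0: "switch_end \<xi> n0"
      using switch_end_after_off_one[OF assms] by blast
    obtain b where b: "\<And>n. switch_end \<xi> n \<Longrightarrow> n \<le> b"
      using switch_end_bounded[OF assms] by blast
    have max: "switch_end \<xi> (bar_prefix_length \<xi>)"
      unfolding n using n0 b by (rule GreatestI_nat)
    then obtain q where q: "bar_prefix_length \<xi> = Suc q" "\<xi> !! q"
      unfolding switch_end_def by blast
    show ?thesis
    proof
      assume "flips s (bar_prefix_length \<xi>)"
      then have "\<not> flips s q"
        by (simp add: q flips_Suc)
      then obtain q' where "q' > q" "switch_end \<xi> (Suc q')"
        using switch_end_after_off_one[OF assms q(2)] by blast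
      then show False
        using Greatest_le_nat[of "switch_end \<xi>" "Suc q'" b] b q(1) n by force
    qed
  qed
qed

lemma bar_snth:
  assumes "k \<ge> bar_prefix_length \<xi>"
  shows "bar \<xi> !! k \<longleftrightarrow> odd (k - bar_prefix_length \<xi>) \<and> \<not> \<xi> !! k"
  using assms by (auto simp: bar_def Let_def shift_snth_ge sdrop_snth)

lemma bar_cofinal_mirror:
  assumes "two_ended_word s \<xi>"
  shows "cofinal_words (bar \<xi>) (mirror s \<xi>)"
proof -
  let ?n = "bar_prefix_length \<xi>"
  obtain M where M: "\<And>k. k \<ge> M \<Longrightarrow> mirror s \<xi> !! k \<longleftrightarrow> flips s k \<and> \<not> \<xi> !! k"
    using mirror_eventually[OF assms] by blast
  have "mirror s \<xi> !! k = bar \<xi> !! k" if "k \<ge> Suc (max M ?n)" for k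
    using that M[of k] bar_snth[of \<xi> k] bar_prefix_length_parity[OF assms]
      odd_diff_iff_flips[of ?n k s] by auto
  then show ?thesis
    unfolding cofinal_words_iff tail_class_def by blast
qed

lemma mirror_not_cofinal:
  assumes "two_ended_word s \<xi>"
  shows "\<not> cofinal_words \<xi> (mirror s \<xi>)"
proof
  assume "cofinal_words \<xi> (mirror s \<xi>)"
  then obtain n where n: "\<And>k. k \<ge> n \<Longrightarrow> mirror s \<xi> !! k = \<xi> !! k"
    by (auto simp: cofinal_words_iff tail_class_def)
  obtain M where M: "\<And>k. k \<ge> M \<Longrightarrow> mirror s \<xi> !! k \<longleftrightarrow> flips s k \<and> \<not> \<xi> !! k"
    using mirror_eventually[OF assms] by blast
  obtain k where "k > max M n" "\<xi> !! k"
    using two_ended_word_later_one[OF assms] by blast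
  then show False
    using n[of k] M[of k] by simp
qed

section \<open>Classification of the two-ended Schreier graphs\<close>

lemma schreier_graph_orbit: "\<eta> \<in> basilica_orbit \<xi> \<Longrightarrow> schreier_graph \<eta> = schreier_graph \<xi>"
  by (simp add: schreier_graph_def orbit_eq)

lemma multigraph_iso_refl: "multigraph_iso G G"
  unfolding multigraph_iso_def
  by (rule exI[of _ id], rule exI[of _ id]) (auto simp: uprod.map_id)

lemma E2_iso: "multigraph_iso (schreier_graph \<xi>) (schreier_graph \<eta>) \<Longrightarrow> \<xi> \<in> E2 \<Longrightarrow> \<eta> \<in> E2"
  using multigraph_iso_imp_schreier_map schreier_map_card_ends by (fastforce simp: E2_def)

lemma iso_class_eq_two_orbits:
  assumes "\<xi> \<in> E2" "two_ended_word s \<xi>"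
  shows "{\<eta>. multigraph_iso (schreier_graph \<xi>) (schreier_graph \<eta>)} =
    basilica_orbit \<xi> \<union> basilica_orbit (mirror s \<xi>)"
proof (intro equalityI subsetI)
  fix \<eta> assume "\<eta> \<in> {\<eta>. multigraph_iso (schreier_graph \<xi>) (schreier_graph \<eta>)}"
  then have iso: "multigraph_iso (schreier_graph \<xi>) (schreier_graph \<eta>)" by simp
  then have "\<eta> \<in> E2"
    using E2_iso assms(1) by blast
  then obtain t where "zeros \<notin> basilica_orbit \<eta>" "two_ended_word t \<eta>"
    using E2_zeros E2_two_ended_word by blast
  moreover obtain f where "schreier_map \<xi> \<eta> f"
    using multigraph_iso_imp_schreier_map[OF iso] by blast
  ultimately show "\<eta> \<in> basilica_orbit \<xi> \<union> basilica_orbit (mirror s \<xi>)"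
    using schreier_map_rigid[OF E2_zeros[OF assms(1)] assms(2)] by blast
next
  fix \<eta> assume "\<eta> \<in> basilica_orbit \<xi> \<union> basilica_orbit (mirror s \<xi>)"
  then have "schreier_graph \<eta> = schreier_graph \<xi> \<or> schreier_graph \<eta> = schreier_graph (mirror s \<xi>)"
    using schreier_graph_orbit by blast
  then show "\<eta> \<in> {\<eta>. multigraph_iso (schreier_graph \<xi>) (schreier_graph \<eta>)}"
    using multigraph_iso_refl schreier_graph_mirror_iso by auto
qed

theorem theorem4p8:
  "(\<forall>\<xi>\<in>E2. \<forall>\<eta>\<in>E2.
      multigraph_iso (schreier_graph \<xi>) (schreier_graph \<eta>) \<longleftrightarrow>
        cofinal_words \<xi> \<eta> \<or> cofinal_words (bar \<xi>) \<eta>) \<and>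
   (\<forall>\<xi>\<in>E2. \<exists>O1 O2.
      O1 \<in> orbits basilica UNIV (\<lambda>g. g) \<and> O2 \<in> orbits basilica UNIV (\<lambda>g. g) \<and> O1 \<noteq> O2 \<and>
      {\<eta>. multigraph_iso (schreier_graph \<xi>) (schreier_graph \<eta>)} = O1 \<union> O2)"
proof (intro conjI ballI)
  fix \<xi> \<eta> assume \<xi>: "\<xi> \<in> E2"
  obtain s where s: "two_ended_word s \<xi>"
    using E2_two_ended_word[OF \<xi>] by blast
  have "mirror s \<xi> \<in> E2"
    using E2_iso[OF schreier_graph_mirror_iso \<xi>] .
  then have "\<eta> \<in> basilica_orbit (mirror s \<xi>) \<longleftrightarrow> cofinal_words (mirror s \<xi>) \<eta>"
    using orbit_eq_cofinal_class[OF E2_zeros] by blast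
  also have "\<dots> \<longleftrightarrow> cofinal_words (bar \<xi>) \<eta>"
    using bar_cofinal_mirror[OF s] cofinal_trans cofinal_sym by blast
  finally show "multigraph_iso (schreier_graph \<xi>) (schreier_graph \<eta>) \<longleftrightarrow>
      cofinal_words \<xi> \<eta> \<or> cofinal_words (bar \<xi>) \<eta>"
    using iso_class_eq_two_orbits[OF \<xi> s] orbit_eq_cofinal_class[OF E2_zeros[OF \<xi>]] by blast
next
  fix \<xi> assume \<xi>: "\<xi> \<in> E2"
  obtain s where s: "two_ended_word s \<xi>"
    using E2_two_ended_word[OF \<xi>] by blast
  have "basilica_orbit \<zeta> \<in> orbits basilica UNIV (\<lambda>g. g)" for \<zeta>
    by (auto simp: orbits_def basilica_orbit_def)
  moreover have "basilica_orbit \<xi> \<noteq> basilica_orbit (mirror s \<xi>)"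
    using mirror_not_cofinal[OF s] orbit_eq_cofinal_class[OF E2_zeros[OF \<xi>]] orbit_self[of "mirror s \<xi>"]
    by auto
  ultimately show "\<exists>O1 O2. O1 \<in> orbits basilica UNIV (\<lambda>g. g) \<and> O2 \<in> orbits basilica UNIV (\<lambda>g. g) \<and>
      O1 \<noteq> O2 \<and> {\<eta>. multigraph_iso (schreier_graph \<xi>) (schreier_graph \<eta>)} = O1 \<union> O2"
    using iso_class_eq_two_orbits[OF \<xi> s] by blast
qed

end
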